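(* Let $G(\boldsymbol{x})=\mathrm{diag}(G_1(\boldsymbol{x}),\ldots,G_t(\boldsymbol{x}))$ be a block-diagonal symmetric real polynomial matrix in $\boldsymbol{x}=(x_1,\ldots,x_n)$, where $G_i$ is a $q_i\times q_i$ symmetric polynomial matrix, $i\in[t]$, and let $\mathbf{K}=\{\boldsymbol{x}\in\mathbb{R}^n\mid G(\boldsymbol{x})\succeq 0\}$. Suppose that $[n]=\bigcup_{i=1}^t I_i$ where: (a) for every $i\in[t]$, all entries of $G_i$ lie in $\mathbb{R}[\boldsymbol{x}(I_i)]$; (b) (running intersection property) for every $i\in[t]\setminus\{1\}$ there is some $k\in[i-1]$ with $I_i\cap\big(\bigcup_{j=1}^{i-1}I_j\big)\subseteq I_k$. For $i\in[t]$ let $\mathbf{K}_i=\{\boldsymbol{x}\in\mathbb{R}^{|I_i|}\mid G_i(\boldsymbol{x})\succeq 0\}$. Suppose further that: (c) if $G$ is linear, each $\mathbf{K}_i$ is compact with nonempty interior (in $\mathbb{R}^{|I_i|}$); otherwise, for each $i\in[t]$, $\mathbf{K}_i$ is compact, $I_{q_i}-G_i\succeq 0$ on $\mathbf{K}_i$, and $\mathbb{R}[\boldsymbol{x}(I_i)]=\mathcal{H}(G_i)-\mathcal{H}(G_i)$. Let $f=\sum_{i=1}^t f_i\in\mathbb{R}[\boldsymbol{x}]$ with $f_i\in\mathbb{R}[\boldsymbol{x}(I_i)]$, $i\in[t]$. If $f$ is positive on $\mathbf{K}$, then $f\in\sum_{i=1}^t\mathcal{H}(G_i)$.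
   Context: $\mathbb{N}$ is the set of nonnegative integers; $\mathbb{R}_+$ the nonnegative reals; $[m]=\{1,\ldots,m\}$; $\mathbb{R}[\boldsymbol{x}(I_i)]$ is the ring of real polynomials in the variables $x_j$, $j\in I_i$. $I_{q}$ (with $q$ a matrix size) denotes the identity matrix, not to be confused with the index sets $I_i$. $\mathbb{S}^{p}_+$ is the set of $p\times p$ real symmetric positive semidefinite matrices; $\langle A,B\rangle=\mathrm{tr}(A^{\intercal}B)$; $U^{\otimes k}$ is the $k$-fold Kronecker power. "Linear" means all entries are polynomials of degree at most one (affine). If $G$ is linear, then for each $i$, $\mathcal{H}(G_i):=\{\lambda_0+\sum_{k=1}^m\langle\Lambda_k,G_i^{\otimes k}\rangle\mid m\in\mathbb{N},\ \lambda_0\in\mathbb{R}_+,\ \Lambda_k\in\mathbb{S}^{q_i^k}_+\}\subset\mathbb{R}[\boldsymbol{x}(I_i)]$. If $G$ is nonlinear, then for each $i$, with $\widetilde{G}_i=\mathrm{diag}(G_i,I_{q_i}-G_i)$, $\mathcal{H}(G_i):=\{\lambda_0+\sum_{k=1}^m\langle\Lambda_k,\widetilde{G}_i^{\otimes k}\rangle\mid m\in\mathbb{N},\ \lambda_0\in\mathbb{R}_+,\ \Lambda_k\in\mathbb{S}^{(2q_i)^k}_+\}\subset\mathbb{R}[\boldsymbol{x}(I_i)]$. The set $\sum_{i=1}^t\mathcal{H}(G_i)$ consists of all sums $\sum_{i=1}^t h_i$ with $h_i\in\mathcal{H}(G_i)$. *)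

theory Defs
  imports
    "HOL-Library.Poly_Mapping"
    "HOL-Analysis.Function_Topology"
    "Jordan_Normal_Form.Matrix"
begin

section \<open>Real polynomials in the variables \<open>x\<^sub>j\<close>, \<open>j :: nat\<close>\<close>

text \<open>
  A monomial is a finitely supported exponent function, a polynomial a finitely supported
  coefficient function on monomials; the ring structure is the convolution product of
  \<^theory>\<open>HOL-Library.Poly_Mapping\<close>.
\<close>

type_synonym mpoly = "(nat \<Rightarrow>\<^sub>0 nat) \<Rightarrow>\<^sub>0 real"

definition mconst :: "real \<Rightarrow> mpoly" where
  "mconst c = Poly_Mapping.single 0 c"

definition mvars :: "mpoly \<Rightarrow> nat set" where
  "mvars p = (\<Union>m\<in>Poly_Mapping.keys p. Poly_Mapping.keys m)"

definition mpoly_ring :: "nat set \<Rightarrow> mpoly set" where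
  "mpoly_ring I = {p. mvars p \<subseteq> I}"

definition total_degree :: "mpoly \<Rightarrow> nat" where
  "total_degree p = Max (insert 0
     ((\<lambda>m. \<Sum>j\<in>Poly_Mapping.keys m. Poly_Mapping.lookup m j) ` Poly_Mapping.keys p))"

definition meval :: "(nat \<Rightarrow> real) \<Rightarrow> mpoly \<Rightarrow> real" where
  "meval x p = (\<Sum>m\<in>Poly_Mapping.keys p.
     Poly_Mapping.lookup p m * (\<Prod>j\<in>Poly_Mapping.keys m. x j ^ Poly_Mapping.lookup m j))"

section \<open>Matrices\<close>

definition sym_mat :: "'a mat \<Rightarrow> bool" where
  "sym_mat A \<longleftrightarrow> transpose_mat A = A"

definition psd :: "real mat \<Rightarrow> bool" where
  "psd A \<longleftrightarrow> sym_mat A \<and> (\<forall>v\<in>carrier_vec (dim_row A). 0 \<le> v \<bullet> (A *\<^sub>v v))"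

definition psd_mats :: "nat \<Rightarrow> real mat set" where
  "psd_mats p = {A \<in> carrier_mat p p. psd A}"

definition mat_trace :: "'a::comm_monoid_add mat \<Rightarrow> 'a" where
  "mat_trace A = (\<Sum>i<dim_row A. A $$ (i, i))"

definition mat_inner :: "'a::semiring_0 mat \<Rightarrow> 'a mat \<Rightarrow> 'a" where
  "mat_inner A B = mat_trace (transpose_mat A * B)"

definition kron :: "'a::times mat \<Rightarrow> 'a mat \<Rightarrow> 'a mat" where
  "kron A B = mat (dim_row A * dim_row B) (dim_col A * dim_col B)
     (\<lambda>(i, j). A $$ (i div dim_row B, j div dim_col B) * B $$ (i mod dim_row B, j mod dim_col B))"

fun kron_pow :: "'a::semiring_1 mat \<Rightarrow> nat \<Rightarrow> 'a mat" where
  "kron_pow A 0 = 1\<^sub>m 1"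
| "kron_pow A (Suc k) = kron A (kron_pow A k)"

definition eval_mat :: "(nat \<Rightarrow> real) \<Rightarrow> mpoly mat \<Rightarrow> real mat" where
  "eval_mat x G = map_mat (meval x) G"

definition linear_mat :: "mpoly mat \<Rightarrow> bool" where
  "linear_mat G \<longleftrightarrow> (\<forall>p\<in>elements_mat G. total_degree p \<le> 1)"

section \<open>Positivity sets\<close>

text \<open>
  The space of real points with coordinates indexed by \<open>I\<close>: its points are the extensional
  functions in \<open>I \<rightarrow>\<^sub>E UNIV\<close>, so for finite \<open>I\<close> it is a copy of Euclidean space of
  dimension \<open>card I\<close>.
\<close>

abbreviation real_space :: "nat set \<Rightarrow> (nat \<Rightarrow> real) topology" where
  "real_space I \<equiv> product_topology (\<lambda>_. euclideanreal) I"

definition psd_set :: "nat set \<Rightarrow> mpoly mat \<Rightarrow> (nat \<Rightarrow> real) set" where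
  "psd_set I G = {x \<in> topspace (real_space I). psd (eval_mat x G)}"

section \<open>The sets \<open>\<H>(G\<^sub>i)\<close>\<close>

definition kron_cone :: "mpoly mat \<Rightarrow> mpoly set" where
  "kron_cone U = {mconst c + (\<Sum>k=1..m. mat_inner (map_mat mconst (L k)) (kron_pow U k)) | m c L.
     0 \<le> c \<and> (\<forall>k\<in>{1..m}. L k \<in> psd_mats (dim_row U ^ k))}"

text \<open>
  In \<^const>\<open>kron_cone\<close> only powers \<open>k \<ge> 1\<close> occur; \<open>kron_pow U 0\<close> is just a recursion base.
  Which of the two forms \<open>\<H>(G\<^sub>i)\<close> takes is decided by the linearity of the whole matrix
  \<open>G\<close>, not of the block \<open>G\<^sub>i\<close>; hence the extra argument.
\<close>

definition H_cone :: "mpoly mat \<Rightarrow> mpoly mat \<Rightarrow> mpoly set" where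
  "H_cone G Gi = (if linear_mat G then kron_cone Gi
     else kron_cone (diag_block_mat [Gi, 1\<^sub>m (dim_row Gi) - Gi]))"

end

theory Submission
  imports "HOL-Analysis.Weierstrass_Theorems" "HOL-Analysis.Function_Metric" Defs
begin

text \<open>
  Analysis reduces the claim to single blocks; each block is then an algebraic problem.

  \<^emph>\<open>Reduction to one block.\<close> Positivity of \<open>f\<close> on \<open>K\<close> concerns points that satisfy all the constraints
  \<open>G\<^sub>i(x) \<succeq> 0\<close> at once. Running intersection allows to rewrite \<open>f = \<Sum>\<^sub>i g\<^sub>i\<close> with \<open>g\<^sub>i\<close> in the variables
  \<open>I\<^sub>i\<close> and positive wherever \<open>G\<^sub>i\<close> alone is positive semidefinite (\<open>positive_decomposition\<close>). One moves
  polynomials in shared variables from one summand to another. If \<open>p(x) + q(z) > 0\<close> whenever \<open>x \<in> A\<close> and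
  \<open>z \<in> B\<close> agree on the shared coordinates \<open>J\<close>, then by compactness \<open>p(x) + q(z) + M d\<^sub>J(x, z) > 0\<close> for all
  \<open>x \<in> A\<close>, \<open>z \<in> B\<close> and some \<open>M\<close>. So the Lipschitz function \<open>y \<mapsto> sup\<^sub>x (- p(x) - M d\<^sub>J(x, y))\<close>, slightly
  raised, separates \<open>- p\<close> from \<open>q\<close>, and Stone-Weierstrass replaces it by a polynomial in \<open>J\<close>
  (\<open>separating_polynomial\<close>).

  \<^emph>\<open>One block.\<close> Let \<open>U\<close> be \<open>G\<^sub>i\<close> or \<open>diag(G\<^sub>i, 1 - G\<^sub>i)\<close>. The cone \<open>\<H>(U)\<close> is closed under multiplication by
  every quadratic form \<open>v\<^sup>T U v\<close>, because \<open>(v\<^sup>T U v) \<langle>L, U\<^sup>k\<rangle> = \<langle>v v\<^sup>T \<otimes> L, U\<^sup>k\<^sup>+\<^sup>1\<rangle>\<close> (Kronecker powers) and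
  \<open>v v\<^sup>T \<otimes> L\<close> is positive semidefinite. Hence the multipliers of \<open>\<H>(U)\<close> form a semiring \<open>T \<subseteq> \<H>(U)\<close>, and
  \<open>U(x) \<succeq> 0\<close> at every point where all of \<open>T\<close> is nonnegative. It remains to see that a polynomial which is
  positive at these points lies in \<open>T\<close>; this is the Archimedean Positivstellensatz for semirings
  (\<open>positive_mem\<close>). For its proof, let \<open>N \<plusminus> x\<^sub>j \<in> T\<close>. A polynomial that is positive on the whole cube
  \<open>[- N, N]\<^sup>I\<close> has nonnegative Bernstein coefficients in high degree, and so lies in \<open>T\<close>. Any other \<open>f\<close> is
  first corrected by \<open>t = \<Sum>\<^sub>g g (1 - g)\<^sup>m\<close> with \<open>m\<close> odd and finitely many \<open>g, 1 - g \<in> T\<close>: this \<open>t\<close> is never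
  larger than a multiple of \<open>1 / m\<close>, and it is very negative where some \<open>g\<close> is negative, so that \<open>f - t\<close> is
  positive on the cube while \<open>t \<in> T\<close>.

  \<^emph>\<open>The Archimedean property\<close> of \<open>T\<close> has a different reason in the two cases. If \<open>U = diag(G\<^sub>i, 1 - G\<^sub>i)\<close>, the
  trace of \<open>U\<close> is constant, which bounds its diagonal and then all its entries. Elements bounded by \<open>T\<close> form
  a ring, so \<open>\<H>(U) - \<H>(U)\<close>, the whole polynomial ring, is bounded (\<open>bounded_of_constant_trace\<close>). If \<open>G\<close> is linear, then
  the bounds \<open>N \<plusminus> x\<^sub>j\<close> are affine functions positive on a compact spectrahedron, and a Farkas lemma
  (\<open>affine_farkas\<close>) puts them into the cone generated by \<open>1\<close> and the forms \<open>v\<^sup>T U v\<close>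
  (\<open>bounded_of_compact_spectrahedron\<close>).
\<close>

section \<open>Evaluation and subrings of polynomials\<close>

definition mvar :: "nat \<Rightarrow> mpoly" where
  "mvar j = Poly_Mapping.single (Poly_Mapping.single j 1) 1"

lemma mconst_0 [simp]: "mconst 0 = 0"
  and mconst_1 [simp]: "mconst 1 = 1"
  and mconst_add: "mconst (a + b) = mconst a + mconst b"
  and mconst_diff: "mconst (a - b) = mconst a - mconst b"
  and mconst_uminus: "mconst (- a) = - mconst a"
  and mconst_mult: "mconst (a * b) = mconst a * mconst b"
  by (simp_all add: mconst_def single_add single_diff single_uminus mult_single)

lemma mconst_prod: "mconst (prod f A) = (\<Prod>a\<in>A. mconst (f a))"
  by (induction A rule: infinite_finite_induct) (simp_all add: mconst_mult)

lemma mconst_of_nat: "mconst (of_nat k) = of_nat k"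
  by (simp add: mconst_def)

lemma meval_superset:
  assumes "finite S" "Poly_Mapping.keys p \<subseteq> S"
  shows "meval x p = (\<Sum>m\<in>S. Poly_Mapping.lookup p m *
           (\<Prod>j\<in>Poly_Mapping.keys m. x j ^ Poly_Mapping.lookup m j))"
  unfolding meval_def using assms by (intro sum.mono_neutral_left) (auto simp: in_keys_iff)

lemma meval_add [simp]: "meval x (p + q) = meval x p + meval x q"
proof -
  let ?S = "Poly_Mapping.keys p \<union> Poly_Mapping.keys q"
  have "Poly_Mapping.keys (p + q) \<subseteq> ?S"
    by (rule keys_add)
  then show ?thesis
    by (simp add: meval_superset[of ?S] lookup_add distrib_right sum.distrib)
qed

lemma meval_single:
  "meval x (Poly_Mapping.single m c) =
     c * (\<Prod>j\<in>Poly_Mapping.keys m. x j ^ Poly_Mapping.lookup m j)"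
  by (simp add: meval_superset[of "{m}"])

lemma meval_0 [simp]: "meval x 0 = 0"
  by (simp add: meval_def)

lemma meval_sum [simp]: "meval x (sum f A) = (\<Sum>a\<in>A. meval x (f a))"
  by (induction A rule: infinite_finite_induct) simp_all

lemma monomial_value_add:
  "(\<Prod>j\<in>Poly_Mapping.keys (m + n). x j ^ Poly_Mapping.lookup (m + n) j) =
   (\<Prod>j\<in>Poly_Mapping.keys m. x j ^ Poly_Mapping.lookup m j) *
   (\<Prod>j\<in>Poly_Mapping.keys n. x j ^ Poly_Mapping.lookup n j)" 
  for x :: "nat \<Rightarrow> real" and m n :: "nat \<Rightarrow>\<^sub>0 nat"
proof -
  let ?S = "Poly_Mapping.keys m \<union> Poly_Mapping.keys n"
  have ext: "(\<Prod>j\<in>Poly_Mapping.keys k. x j ^ Poly_Mapping.lookup k j) =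
        (\<Prod>j\<in>?S. x j ^ Poly_Mapping.lookup k j)" if "Poly_Mapping.keys k \<subseteq> ?S" for k
    using that by (intro prod.mono_neutral_left) (auto simp: in_keys_iff)
  show ?thesis
    unfolding ext[OF keys_add] ext[OF Un_upper1] ext[OF Un_upper2]
    by (simp add: lookup_add power_add prod.distrib)
qed

lemma mpoly_as_sum: "p = (\<Sum>m\<in>Poly_Mapping.keys p. Poly_Mapping.single m (Poly_Mapping.lookup p m))"
  for p :: mpoly
proof (rule poly_mapping_eqI)
  fix k
  show "Poly_Mapping.lookup p k = Poly_Mapping.lookup
     (\<Sum>m\<in>Poly_Mapping.keys p. Poly_Mapping.single m (Poly_Mapping.lookup p m)) k"
    by (simp add: lookup_sum lookup_single when_def in_keys_iff)
qed

lemma meval_mult [simp]: "meval x (p * q) = meval x p * meval x q"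
proof -
  let ?s = "\<lambda>p m. Poly_Mapping.single m (Poly_Mapping.lookup p m) :: mpoly"
  have "meval x (p * q) = meval x ((\<Sum>m\<in>Poly_Mapping.keys p. ?s p m) * (\<Sum>m\<in>Poly_Mapping.keys q. ?s q m))"
    using mpoly_as_sum[of p] mpoly_as_sum[of q] by simp
  also have "\<dots> = (\<Sum>m\<in>Poly_Mapping.keys p. meval x (?s p m)) * (\<Sum>m\<in>Poly_Mapping.keys q. meval x (?s q m))"
    by (simp add: sum_product mult_single meval_single monomial_value_add algebra_simps)
  also have "\<dots> = meval x p * meval x q"
    using mpoly_as_sum[of p] mpoly_as_sum[of q] by (metis meval_sum)
  finally show ?thesis .
qed

lemma meval_mconst [simp]: "meval x (mconst c) = c"
  by (simp add: mconst_def meval_single)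

lemma meval_1 [simp]: "meval x 1 = 1"
  using meval_mconst[of x 1] by simp

lemma meval_mvar [simp]: "meval x (mvar j) = x j"
  by (simp add: mvar_def meval_single)

lemma meval_uminus [simp]: "meval x (- p) = - meval x p"
  using meval_add[of x p "- p"] by simp

lemma meval_diff [simp]: "meval x (p - q) = meval x p - meval x q"
  using meval_add[of x p "- q"] by simp

lemma meval_power [simp]: "meval x (p ^ k) = meval x p ^ k"
  by (induction k) simp_all

lemma meval_prod [simp]: "meval x (prod f A) = (\<Prod>a\<in>A. meval x (f a))"
  by (induction A rule: infinite_finite_induct) simp_all

lemma continuous_meval: "continuous_on A (\<lambda>x. meval x p)"
  unfolding meval_def
  by (intro continuous_on_sum continuous_on_mult continuous_on_const continuous_on_prod
      continuous_on_power continuous_on_subset[OF continuous_on_product_coordinates subset_UNIV])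

lemma mpoly_ring_mconst [simp]: "mconst c \<in> mpoly_ring I"
  by (auto simp: mpoly_ring_def mvars_def mconst_def split: if_splits)

lemma mpoly_ring_0 [simp]: "0 \<in> mpoly_ring I"
  and mpoly_ring_1 [simp]: "1 \<in> mpoly_ring I"
  using mpoly_ring_mconst[of 0 I] mpoly_ring_mconst[of 1 I] by simp_all

lemma mpoly_ring_mvar [simp]: "j \<in> I \<Longrightarrow> mvar j \<in> mpoly_ring I"
  by (auto simp: mpoly_ring_def mvars_def mvar_def)

lemma mpoly_ring_add: "p \<in> mpoly_ring I \<Longrightarrow> q \<in> mpoly_ring I \<Longrightarrow> p + q \<in> mpoly_ring I"
  using keys_add[of p q] unfolding mpoly_ring_def mvars_def by blast

lemma mpoly_ring_mult: "p \<in> mpoly_ring I \<Longrightarrow> q \<in> mpoly_ring I \<Longrightarrow> p * q \<in> mpoly_ring I"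
proof -
  assume *: "p \<in> mpoly_ring I" "q \<in> mpoly_ring I"
  have "Poly_Mapping.keys k \<subseteq> I" if k_in: "k \<in> Poly_Mapping.keys (p * q)" for k
  proof -
    obtain m n where k: "k = m + n" "m \<in> Poly_Mapping.keys p" "n \<in> Poly_Mapping.keys q"
      using k_in keys_mult[of p q] by auto
    have "Poly_Mapping.keys m \<subseteq> I" "Poly_Mapping.keys n \<subseteq> I"
      using * k by (auto simp: mpoly_ring_def mvars_def)
    then show ?thesis
      unfolding k(1) using keys_add[of m n] by auto
  qed
  then show ?thesis
    by (auto simp: mpoly_ring_def mvars_def)
qed

lemma mpoly_ring_uminus: "p \<in> mpoly_ring I \<Longrightarrow> - p \<in> mpoly_ring I"
  using mpoly_ring_mult[of "mconst (- 1)" I p] by (simp add: mpoly_ring_def mvars_def keys_minus)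

lemma mpoly_ring_diff: "p \<in> mpoly_ring I \<Longrightarrow> q \<in> mpoly_ring I \<Longrightarrow> p - q \<in> mpoly_ring I"
  using mpoly_ring_add[OF _ mpoly_ring_uminus, of p I q] by simp

lemma mpoly_ring_sum: "(\<And>a. a \<in> A \<Longrightarrow> f a \<in> mpoly_ring I) \<Longrightarrow> sum f A \<in> mpoly_ring I"
  by (induction A rule: infinite_finite_induct) (simp_all add: mpoly_ring_add)

lemma mpoly_ring_mono: "I \<subseteq> J \<Longrightarrow> mpoly_ring I \<subseteq> mpoly_ring J"
  by (auto simp: mpoly_ring_def)

lemma meval_cong:
  assumes "p \<in> mpoly_ring I" "\<And>j. j \<in> I \<Longrightarrow> x j = y j"
  shows "meval x p = meval y p"
  unfolding meval_def
proof (rule sum.cong[OF refl])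
  fix m assume "m \<in> Poly_Mapping.keys p"
  then have "Poly_Mapping.keys m \<subseteq> I"
    using assms(1) by (auto simp: mpoly_ring_def mvars_def)
  then have "(\<Prod>j\<in>Poly_Mapping.keys m. x j ^ Poly_Mapping.lookup m j) =
      (\<Prod>j\<in>Poly_Mapping.keys m. y j ^ Poly_Mapping.lookup m j)"
    using assms(2) by (intro prod.cong) auto
  then show "Poly_Mapping.lookup p m * (\<Prod>j\<in>Poly_Mapping.keys m. x j ^ Poly_Mapping.lookup m j) =
      Poly_Mapping.lookup p m * (\<Prod>j\<in>Poly_Mapping.keys m. y j ^ Poly_Mapping.lookup m j)"
    by simp
qed

text \<open>
  Peeling off one variable at a time lets a property of polynomials be checked on generators only, without
  any bookkeeping of exponents.
\<close>

lemma mpoly_ring_induct [consumes 1, case_names const add mvar]: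
  assumes "p \<in> mpoly_ring I"
    and const: "\<And>c. P (mconst c)"
    and add: "\<And>a b. P a \<Longrightarrow> P b \<Longrightarrow> P (a + b)"
    and mvar: "\<And>j a. j \<in> I \<Longrightarrow> P a \<Longrightarrow> P (mvar j * a)"
  shows "P p"
proof -
  have single: "P (Poly_Mapping.single m c)" if "Poly_Mapping.keys m \<subseteq> I" for m :: "nat \<Rightarrow>\<^sub>0 nat" and c
    using that
  proof (induction "\<Sum>j\<in>Poly_Mapping.keys m. Poly_Mapping.lookup m j" arbitrary: m rule: less_induct)
    case less
    show ?case
    proof (cases "m = 0")
      case True
      then show ?thesis using const[of c] by (simp add: mconst_def)
    next
      case False
      then obtain j where j: "j \<in> Poly_Mapping.keys m"
        by (metis ex_in_conv keys_eq_empty)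
      define m' where "m' = m - Poly_Mapping.single j 1"
      have lj: "Poly_Mapping.lookup m j \<ge> 1"
        using j by (simp add: in_keys_iff)
      have lm': "Poly_Mapping.lookup m' i = Poly_Mapping.lookup m i - (if i = j then 1 else 0)" for i
        by (simp add: m'_def lookup_minus lookup_single when_def)
      have m: "m = Poly_Mapping.single j 1 + m'"
        by (rule poly_mapping_eqI) (use lj in \<open>auto simp: lookup_add lm' lookup_single when_def\<close>)
      have keys: "Poly_Mapping.keys m' \<subseteq> Poly_Mapping.keys m"
        by (auto simp: in_keys_iff lm')
      have "(\<Sum>i\<in>Poly_Mapping.keys m'. Poly_Mapping.lookup m' i) = (\<Sum>i\<in>Poly_Mapping.keys m. Poly_Mapping.lookup m' i)"
        using keys by (intro sum.mono_neutral_left) (auto simp: in_keys_iff)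
      also have "\<dots> < (\<Sum>i\<in>Poly_Mapping.keys m. Poly_Mapping.lookup m i)"
        using j lj by (intro sum_strict_mono_ex1) (auto simp: lm')
      finally have "P (Poly_Mapping.single m' c)"
        using less keys by blast
      then have "P (mvar j * Poly_Mapping.single m' c)"
        using mvar j less.prems by blast
      then show ?thesis
        by (subst m) (simp add: mvar_def mult_single)
    qed
  qed
  have P0: "P 0"
    using const[of 0] by simp
  have "P (\<Sum>m\<in>S. Poly_Mapping.single m (Poly_Mapping.lookup p m))" if "finite S" "S \<subseteq> Poly_Mapping.keys p" for S
    using that assms(1)
    by (induction S rule: finite_induct) (auto intro!: add single P0 simp: mpoly_ring_def mvars_def)
  then show ?thesis
    using mpoly_as_sum[of p] by (metis finite_keys subset_refl)
qed

section \<open>Compactness in coordinate space\<close>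

lemma compact_coordinate_box:
  fixes S :: "nat \<Rightarrow> real set"
  assumes "\<And>j. compact (S j)"
  shows "compact {x. \<forall>j. x j \<in> S j}"
proof -
  have "compactin (product_topology (\<lambda>_. euclidean) UNIV) (PiE UNIV S)"
    using assms by (subst compactin_PiE) auto
  then show ?thesis
    by (simp add: euclidean_product_topology PiE_UNIV_domain Pi_def)
qed

text \<open>
  Coordinates outside \<open>I\<close> are frozen at \<open>0\<close>, so that the box is compact in the full space of sequences.
\<close>

definition coord_box :: "nat set \<Rightarrow> real \<Rightarrow> (nat \<Rightarrow> real) set" where
  "coord_box I N = {x. (\<forall>j\<in>I. \<bar>x j\<bar> \<le> N) \<and> (\<forall>j. j \<notin> I \<longrightarrow> x j = 0)}"

lemma compact_coord_box: "compact (coord_box I N)"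
proof -
  have "coord_box I N = {x. \<forall>j. x j \<in> (if j \<in> I then {-N..N} else {0})}"
    by (auto simp: coord_box_def abs_le_iff minus_le_iff split: if_splits; metis)
  also have "compact \<dots>"
    by (rule compact_coordinate_box) auto
  finally show ?thesis .
qed

lemma continuous_pos_bounded_below:
  fixes g :: "'a::topological_space \<Rightarrow> real"
  assumes "compact S" "continuous_on S g" "\<And>x. x \<in> S \<Longrightarrow> 0 < g x"
  obtains e where "0 < e" "\<And>x. x \<in> S \<Longrightarrow> e \<le> g x"
proof (cases "S = {}")
  case True
  then show ?thesis using that[of 1] by auto
next
  case False
  then obtain x where "x \<in> S" "\<forall>y\<in>S. g x \<le> g y"
    using continuous_attains_inf[OF assms(1) _ assms(2)] by auto
  then show ?thesis
    using assms(3) that[of "g x"] by auto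
qed

lemma continuous_bounded_below:
  fixes g :: "'a::topological_space \<Rightarrow> real"
  assumes "compact S" "continuous_on S g"
  obtains b where "0 \<le> b" "\<And>x. x \<in> S \<Longrightarrow> - b \<le> g x"
proof (cases "S = {}")
  case True
  then show ?thesis using that[of 0] by auto
next
  case False
  then obtain x where x: "x \<in> S" "\<forall>y\<in>S. g x \<le> g y"
    using continuous_attains_inf[OF assms(1) _ assms(2)] by auto
  show ?thesis
  proof (rule that[of "\<bar>g x\<bar>"])
    show "- \<bar>g x\<bar> \<le> g y" if "y \<in> S" for y
      using x that by (smt (verit))
  qed simp
qed

section \<open>Bernstein expansions on a cube\<close>

text \<open>
  Expand \<open>y\<^sup>k (y + (1 - y))\<^sup>d\<^sup>-\<^sup>k\<close> by the binomial theorem. The coefficient of the Bernstein polynomial with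
  index \<open>i\<close> is a ratio of binomials that tends to the value \<open>(i / d)\<^sup>k\<close> of the monomial at the grid point.
\<close>

lemma power_eq_bernstein_sum:
  fixes y :: mpoly
  assumes "k \<le> d"
  shows "y ^ k = (\<Sum>i\<le>d. mconst (real (i choose k) / real (d choose k)) *
     (mconst (real (d choose i)) * y ^ i * (1 - y) ^ (d - i)))"
proof -
  define t where "t i = mconst (real (i choose k) / real (d choose k)) *
     (mconst (real (d choose i)) * y ^ i * (1 - y) ^ (d - i))" for i
  have t: "t (i + k) = y ^ k * (of_nat ((d - k) choose i) * y ^ i * (1 - y) ^ (d - k - i))" if "i \<le> d - k" for i
  proof -
    have "(d choose (i + k)) * ((i + k) choose k) = (d choose k) * ((d - k) choose i)"
      using choose_mult[of k "i + k" d] that assms by simp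
    then have "real ((i + k) choose k) * real (d choose (i + k)) = real (d choose k) * real ((d - k) choose i)"
      by (metis mult.commute of_nat_mult)
    then have "real ((i + k) choose k) / real (d choose k) * real (d choose (i + k)) = real ((d - k) choose i)"
      using assms by (simp add: field_simps)
    then have "mconst (real ((i + k) choose k) / real (d choose k)) * mconst (real (d choose (i + k)))
        = of_nat ((d - k) choose i)"
      by (simp flip: mconst_mult mconst_of_nat)
    then have "t (i + k) = of_nat ((d - k) choose i) * y ^ (i + k) * (1 - y) ^ (d - (i + k))"
      unfolding t_def by (simp only: mult.assoc[symmetric])
    then show ?thesis
      by (simp add: power_add algebra_simps)
  qed
  have "y ^ k = y ^ k * (y + (1 - y)) ^ (d - k)"
    by simp
  also have "\<dots> = (\<Sum>i\<le>d - k. t (i + k))"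
    unfolding binomial_ring sum_distrib_left by (intro sum.cong refl) (simp add: t)
  also have "\<dots> = (\<Sum>i=k..d. t i)"
    using sum.shift_bounds_cl_nat_ivl[of t 0 k "d - k"] assms by (simp add: atMost_atLeast0)
  also have "\<dots> = (\<Sum>i\<le>d. t i)"
    by (rule sum.mono_neutral_left) (auto simp: t_def binomial_eq_0)
  finally show ?thesis
    by (simp add: t_def)
qed

text \<open>
  The ratio is \<open>\<Prod>\<^sub>l (i - l) / (d - l)\<close> over \<open>l < k\<close>; each factor lies in \<open>[-1, 1]\<close> and differs from \<open>i / d\<close> by at
  most \<open>2 k / d\<close>. The bound has to be uniform in \<open>i\<close>.
\<close>

lemma binomial_ratio_approx:
  assumes "i \<le> d" "2 * k \<le> d" "0 < d"
  shows "\<bar>real (i choose k) / real (d choose k) - (real i / real d) ^ k\<bar> \<le> 2 * real k ^ 2 / real d"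
proof -
  have prod: "real (i choose k) / real (d choose k) = (\<Prod>l=0..<k. (real i - real l) / (real d - real l))"
  proof -
    have ne: "(\<Prod>l=0..<k. real (k - l)) \<noteq> 0"
      by (auto simp: prod_zero_iff)
    then show ?thesis
      by (simp add: binomial_gbinomial gbinomial_altdef_of_nat prod_dividef)
  qed
  have l_le: "\<bar>(real i - real l) / (real d - real l)\<bar> \<le> 1" if "l < k" for l
    using assms that by (simp add: divide_le_eq)
  have diff: "\<bar>(real i - real l) / (real d - real l) - real i / real d\<bar> \<le> 2 * real k / real d" if "l < k" for l
  proof -
    have pos: "real d - real l \<ge> real d / 2" "real d > 0"
      using assms that by auto
    then have pos': "real d - real l > 0"
      by linarith
    have "(real i - real l) / (real d - real l) - real i / real d =
        - (real l * (real d - real i) / (real d * (real d - real l)))"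
      using pos pos' by (simp add: divide_simps) (simp add: algebra_simps)
    then have "\<bar>(real i - real l) / (real d - real l) - real i / real d\<bar> =
        real l * (real d - real i) / (real d * (real d - real l))"
      using assms pos pos' by simp
    also have "\<dots> \<le> real k * real d / (real d * (real d / 2))"
      using assms that pos pos' by (intro frac_le mult_mono) auto
    also have "\<dots> = 2 * real k / real d"
      using pos by simp
    finally show ?thesis .
  qed
  have "\<bar>(\<Prod>l=0..<k. (real i - real l) / (real d - real l)) - (\<Prod>l=0..<k. real i / real d)\<bar>
      \<le> (\<Sum>l=0..<k. \<bar>(real i - real l) / (real d - real l) - real i / real d\<bar>)"
    using norm_prod_diff[of "{0..<k}" "\<lambda>l. (real i - real l) / (real d - real l)" "\<lambda>l. real i / real d"]
      l_le assms by (simp add: divide_le_eq)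
  also have "\<dots> \<le> (\<Sum>l=0..<k. 2 * real k / real d)"
    by (intro sum_mono) (simp add: diff)
  finally show ?thesis
    by (simp add: prod power2_eq_square mult.left_commute)
qed

locale cube =
  fixes I :: "nat set" and N :: real
  assumes fin: "finite I" and N: "0 < N"
begin

text \<open>
  The affine change of coordinates that maps \<open>[- N, N]\<close> onto \<open>[0, 1]\<close>.
\<close>

definition cvar :: "nat \<Rightarrow> mpoly" where
  "cvar j = mconst (1 / (2 * N)) * (mconst N + mvar j)"

definition indices :: "nat \<Rightarrow> (nat \<Rightarrow> nat) set" where
  "indices d = PiE I (\<lambda>_. {..d})"

definition bernstein :: "nat \<Rightarrow> (nat \<Rightarrow> nat) \<Rightarrow> mpoly" where
  "bernstein d i = (\<Prod>j\<in>I. mconst (real (d choose i j)) * cvar j ^ i j * (1 - cvar j) ^ (d - i j))"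

definition grid :: "nat \<Rightarrow> (nat \<Rightarrow> nat) \<Rightarrow> nat \<Rightarrow> real" where
  "grid d i j = (if j \<in> I then 2 * N * (real (i j) / real d) - N else 0)"

text \<open>
  The coefficients of \<open>p\<close> in some Bernstein expansion of degree \<open>d\<close> in each variable agree with the values of
  \<open>p\<close> on the grid up to \<open>O(1 / d)\<close>. This is stable under linear combinations, but not evidently under
  products.
\<close>

definition approximable :: "mpoly \<Rightarrow> bool" where
  "approximable p \<longleftrightarrow> (\<exists>C D. \<forall>d\<ge>D. \<exists>c. p = (\<Sum>i\<in>indices d. mconst (c i) * bernstein d i) \<and>
     (\<forall>i\<in>indices d. \<bar>c i - meval (grid d i) p\<bar> \<le> C / real d))"

lemma mvar_eq_cvar: "mvar j = mconst (2 * N) * cvar j - mconst N"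
proof -
  have "mconst (2 * N) * cvar j = mconst (2 * N * (1 / (2 * N))) * (mconst N + mvar j)"
    unfolding cvar_def mconst_mult[of "2 * N" "1 / (2 * N)"] by (simp only: mult.assoc)
  also have "2 * N * (1 / (2 * N)) = 1"
    using N by simp
  finally show ?thesis
    by simp
qed

lemma approximable_monomial: "approximable (\<Prod>j\<in>I. cvar j ^ \<alpha> j)"
proof -
  define C where "C = (\<Sum>j\<in>I. 2 * real (\<alpha> j) ^ 2)"
  \<comment> \<open>Guarantees \<open>2 \<alpha>\<^sub>j \<le> d\<close> and \<open>0 < d\<close>.\<close>
  define D where "D = 2 * (\<Sum>j\<in>I. \<alpha> j) + 1"
  show ?thesis
    unfolding approximable_def
  proof (rule exI[of _ C], rule exI[of _ D], intro allI impI)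
    fix d assume d: "D \<le> d"
    have \<alpha>: "2 * \<alpha> j \<le> d" if "j \<in> I" for j
      using d member_le_sum[OF that, of \<alpha>] fin by (simp add: D_def)
    have d0: "0 < d"
      using d by (simp add: D_def)
    define c where "c i = (\<Prod>j\<in>I. real (i j choose \<alpha> j) / real (d choose \<alpha> j))" for i
    have "(\<Prod>j\<in>I. cvar j ^ \<alpha> j) = (\<Prod>j\<in>I. \<Sum>i\<le>d. mconst (real (i choose \<alpha> j) / real (d choose \<alpha> j)) *
       (mconst (real (d choose i)) * cvar j ^ i * (1 - cvar j) ^ (d - i)))"
      using \<alpha> by (intro prod.cong power_eq_bernstein_sum) force+
    also have "\<dots> = (\<Sum>i\<in>indices d. mconst (c i) * bernstein d i)"
      unfolding indices_def using fin
      by (subst prod_sum_PiE) (simp_all add: c_def bernstein_def mconst_prod prod.distrib)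
    finally have 1: "(\<Prod>j\<in>I. cvar j ^ \<alpha> j) = (\<Sum>i\<in>indices d. mconst (c i) * bernstein d i)" .
    have "\<bar>c i - meval (grid d i) (\<Prod>j\<in>I. cvar j ^ \<alpha> j)\<bar> \<le> C / real d" if i: "i \<in> indices d" for i
    proof -
      have ij: "i j \<le> d" if "j \<in> I" for j
        using i that by (auto simp: indices_def PiE_iff)
      have "meval (grid d i) (\<Prod>j\<in>I. cvar j ^ \<alpha> j) = (\<Prod>j\<in>I. (real (i j) / real d) ^ \<alpha> j)"
        using N by (simp add: cvar_def grid_def)
      then have "\<bar>c i - meval (grid d i) (\<Prod>j\<in>I. cvar j ^ \<alpha> j)\<bar> \<le>
         (\<Sum>j\<in>I. \<bar>real (i j choose \<alpha> j) / real (d choose \<alpha> j) - (real (i j) / real d) ^ \<alpha> j\<bar>)"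
        using norm_prod_diff[of I "\<lambda>j. real (i j choose \<alpha> j) / real (d choose \<alpha> j)" "\<lambda>j. (real (i j) / real d) ^ \<alpha> j"]
          ij d0 \<alpha> by (simp add: c_def power_le_one_iff divide_le_eq binomial_right_mono)
      also have "\<dots> \<le> (\<Sum>j\<in>I. 2 * real (\<alpha> j) ^ 2 / real d)"
        by (intro sum_mono binomial_ratio_approx ij \<alpha> d0)
      finally show ?thesis
        by (simp add: C_def sum_divide_distrib)
    qed
    then show "\<exists>c. (\<Prod>j\<in>I. cvar j ^ \<alpha> j) = (\<Sum>i\<in>indices d. mconst (c i) * bernstein d i) \<and>
        (\<forall>i\<in>indices d. \<bar>c i - meval (grid d i) (\<Prod>j\<in>I. cvar j ^ \<alpha> j)\<bar> \<le> C / real d)"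
      using 1 by blast
  qed
qed

lemma approximable_add:
  assumes "approximable p" "approximable q"
  shows "approximable (p + q)"
proof -
  obtain C1 D1 where 1: "\<forall>d\<ge>D1. \<exists>c. p = (\<Sum>i\<in>indices d. mconst (c i) * bernstein d i) \<and>
     (\<forall>i\<in>indices d. \<bar>c i - meval (grid d i) p\<bar> \<le> C1 / real d)"
    using assms(1) unfolding approximable_def by blast
  obtain C2 D2 where 2: "\<forall>d\<ge>D2. \<exists>c. q = (\<Sum>i\<in>indices d. mconst (c i) * bernstein d i) \<and>
     (\<forall>i\<in>indices d. \<bar>c i - meval (grid d i) q\<bar> \<le> C2 / real d)"
    using assms(2) unfolding approximable_def by blast
  show ?thesis
    unfolding approximable_def
  proof (rule exI[of _ "C1 + C2"], rule exI[of _ "max D1 D2"], intro allI impI)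
    fix d assume d: "max D1 D2 \<le> d"
    obtain c1 where c1: "p = (\<Sum>i\<in>indices d. mconst (c1 i) * bernstein d i)"
      "\<forall>i\<in>indices d. \<bar>c1 i - meval (grid d i) p\<bar> \<le> C1 / real d"
      using 1 d by auto
    obtain c2 where c2: "q = (\<Sum>i\<in>indices d. mconst (c2 i) * bernstein d i)"
      "\<forall>i\<in>indices d. \<bar>c2 i - meval (grid d i) q\<bar> \<le> C2 / real d"
      using 2 d by auto
    have "p + q = (\<Sum>i\<in>indices d. mconst (c1 i + c2 i) * bernstein d i)"
      by (simp add: mconst_add distrib_right sum.distrib flip: c1(1) c2(1))
    moreover have "\<bar>(c1 i + c2 i) - meval (grid d i) (p + q)\<bar> \<le> (C1 + C2) / real d" if "i \<in> indices d" for i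
      using c1(2)[rule_format, OF that] c2(2)[rule_format, OF that] by (simp add: add_divide_distrib)
    ultimately show "\<exists>c. p + q = (\<Sum>i\<in>indices d. mconst (c i) * bernstein d i) \<and>
       (\<forall>i\<in>indices d. \<bar>c i - meval (grid d i) (p + q)\<bar> \<le> (C1 + C2) / real d)"
      by (intro exI[of _ "\<lambda>i. c1 i + c2 i"]) blast
  qed
qed

lemma approximable_smult:
  assumes "approximable p"
  shows "approximable (mconst a * p)"
proof -
  obtain C D where 1: "\<forall>d\<ge>D. \<exists>c. p = (\<Sum>i\<in>indices d. mconst (c i) * bernstein d i) \<and>
     (\<forall>i\<in>indices d. \<bar>c i - meval (grid d i) p\<bar> \<le> C / real d)"
    using assms(1) unfolding approximable_def by blast
  show ?thesis
    unfolding approximable_def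
  proof (rule exI[of _ "\<bar>a\<bar> * C"], rule exI[of _ D], intro allI impI)
    fix d assume d: "D \<le> d"
    obtain c where c: "p = (\<Sum>i\<in>indices d. mconst (c i) * bernstein d i)"
      "\<forall>i\<in>indices d. \<bar>c i - meval (grid d i) p\<bar> \<le> C / real d"
      using 1 d by auto
    have "mconst a * p = (\<Sum>i\<in>indices d. mconst (a * c i) * bernstein d i)"
      by (subst c(1)) (simp add: sum_distrib_left mconst_mult mult.assoc)
    moreover have "\<bar>a * c i - meval (grid d i) (mconst a * p)\<bar> \<le> \<bar>a\<bar> * C / real d" if "i \<in> indices d" for i
    proof -
      have "\<bar>a * c i - meval (grid d i) (mconst a * p)\<bar> = \<bar>a\<bar> * \<bar>c i - meval (grid d i) p\<bar>"
        by (simp flip: abs_mult right_diff_distrib)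
      also have "\<dots> \<le> \<bar>a\<bar> * (C / real d)"
        using c(2)[rule_format, OF that] by (intro mult_left_mono) auto
      finally show ?thesis
        by simp
    qed
    ultimately show "\<exists>c. mconst a * p = (\<Sum>i\<in>indices d. mconst (c i) * bernstein d i) \<and>
       (\<forall>i\<in>indices d. \<bar>c i - meval (grid d i) (mconst a * p)\<bar> \<le> \<bar>a\<bar> * C / real d)"
      by (intro exI[of _ "\<lambda>i. a * c i"]) blast
  qed
qed

text \<open>
  In place of stability under products, the induction carries an arbitrary monomial in the \<open>cvar j\<close> along:
  multiplication by a variable only changes its exponents.
\<close>

lemma approximable_mpoly_ring:
  assumes "p \<in> mpoly_ring I"
  shows "approximable p"
proof -
  have "\<forall>\<alpha>. approximable (p * (\<Prod>j\<in>I. cvar j ^ \<alpha> j))"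
    using assms
  proof (induction p rule: mpoly_ring_induct)
    case (const c)
    then show ?case
      by (simp add: approximable_smult approximable_monomial)
  next
    case (add a b)
    then show ?case
      by (simp add: distrib_right approximable_add)
  next
    case (mvar j a)
    show ?case
    proof
      fix \<alpha> :: "nat \<Rightarrow> nat"
      define M where "M = (\<Prod>i\<in>I. cvar i ^ \<alpha> i)"
      define M' where "M' = (\<Prod>i\<in>I. cvar i ^ (\<alpha>(j := Suc (\<alpha> j))) i)"
      have M': "M' = cvar j * M"
        unfolding M_def M'_def using fin mvar(1) by (simp add: prod.remove[of I j] mult.assoc)
      have "mvar j * a * M = mconst (2 * N) * (a * M') + mconst (- N) * (a * M)"
        unfolding M' mvar_eq_cvar by (simp add: mconst_uminus algebra_simps)
      then show "approximable (mvar j * a * (\<Prod>i\<in>I. cvar i ^ \<alpha> i))"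
        using mvar(2) by (simp add: M_def M'_def approximable_add approximable_smult)
    qed
  qed
  from spec[OF this, of "\<lambda>_. 0"] show ?thesis
    by simp
qed

text \<open>
  Bernstein's theorem: the coefficients are close to values of \<open>f\<close> on the cube, which are bounded away
  from \<open>0\<close>.
\<close>

lemma positive_on_cube_bernstein:
  assumes f: "f \<in> mpoly_ring I" and pos: "\<And>x. x \<in> coord_box I N \<Longrightarrow> 0 < meval x f"
  obtains d c where "f = (\<Sum>i\<in>indices d. mconst (c i) * bernstein d i)"
    "\<And>i. i \<in> indices d \<Longrightarrow> 0 \<le> c i"
proof -
  obtain e where e: "0 < e" "\<And>x. x \<in> coord_box I N \<Longrightarrow> e \<le> meval x f"
    using continuous_pos_bounded_below[OF compact_coord_box continuous_meval pos] by blast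
  obtain C D where CD: "\<forall>d\<ge>D. \<exists>c. f = (\<Sum>i\<in>indices d. mconst (c i) * bernstein d i) \<and>
     (\<forall>i\<in>indices d. \<bar>c i - meval (grid d i) f\<bar> \<le> C / real d)"
    using approximable_mpoly_ring[OF f] unfolding approximable_def by blast
  obtain k :: nat where k: "C / e \<le> real k"
    using real_arch_simple by blast
  define d where "d = Suc (max D k)"
  have "C \<le> e * real k"
    using k e(1) by (simp add: field_simps)
  also have "\<dots> \<le> e * real d"
    using e(1) by (simp add: d_def)
  finally have Cd: "C / real d \<le> e"
    by (simp add: d_def field_simps)
  obtain c where c: "f = (\<Sum>i\<in>indices d. mconst (c i) * bernstein d i)"
      "\<forall>i\<in>indices d. \<bar>c i - meval (grid d i) f\<bar> \<le> C / real d"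
    using CD by (metis d_def le_SucI max.cobounded1)
  have "0 \<le> c i" if i: "i \<in> indices d" for i
  proof -
    have "0 \<le> real (i j) / real d \<and> real (i j) / real d \<le> 1" if "j \<in> I" for j
      using i that by (auto simp: indices_def PiE_iff divide_le_eq)
    then have "0 \<le> 2 * N * (real (i j) / real d) \<and> 2 * N * (real (i j) / real d) \<le> 2 * N" if "j \<in> I" for j
      using N that mult_left_le[of "real (i j) / real d" "2 * N"] by simp
    then have "grid d i \<in> coord_box I N"
      by (auto simp: coord_box_def grid_def abs_le_iff)
    then have "e \<le> meval (grid d i) f"
      by (rule e(2))
    moreover have "\<bar>c i - meval (grid d i) f\<bar> \<le> e"
      using c(2)[rule_format, OF i] Cd by linarith
    ultimately show ?thesis
      by linarith
  qed
  then show ?thesis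
    using that c(1) by blast
qed

end

section \<open>Archimedean semirings of polynomials\<close>

locale poly_semiring =
  fixes T :: "mpoly set" and I :: "nat set"
  assumes sub: "T \<subseteq> mpoly_ring I"
    and const: "\<And>c. 0 \<le> c \<Longrightarrow> mconst c \<in> T"
    and add: "\<And>a b. a \<in> T \<Longrightarrow> b \<in> T \<Longrightarrow> a + b \<in> T"
    and mult: "\<And>a b. a \<in> T \<Longrightarrow> b \<in> T \<Longrightarrow> a * b \<in> T"
begin

lemma zero: "0 \<in> T" and one: "1 \<in> T"
  using const[of 0] const[of 1] by simp_all

lemma sum: "(\<And>a. a \<in> A \<Longrightarrow> f a \<in> T) \<Longrightarrow> sum f A \<in> T"
  by (induction A rule: infinite_finite_induct) (auto intro: zero add)

lemma prod: "(\<And>a. a \<in> A \<Longrightarrow> f a \<in> T) \<Longrightarrow> prod f A \<in> T"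
  by (induction A rule: infinite_finite_induct) (auto intro: one mult)

lemma power: "a \<in> T \<Longrightarrow> a ^ k \<in> T"
  by (induction k) (auto intro: one mult)

definition bounded_elems :: "mpoly set" where
  "bounded_elems = {a. \<exists>N\<ge>0. mconst N + a \<in> T \<and> mconst N - a \<in> T}"

text \<open>
  The bound may be negative here when \<open>T\<close> contains \<open>-1\<close>; it can always be enlarged.
\<close>

lemma bounded_elemsI: "mconst N + a \<in> T \<Longrightarrow> mconst N - a \<in> T \<Longrightarrow> a \<in> bounded_elems"
proof -
  assume a: "mconst N + a \<in> T" "mconst N - a \<in> T"
  have c: "mconst (\<bar>N\<bar> - N) \<in> T"
    by (rule const) simp
  have eq: "mconst (\<bar>N\<bar> - N) + (mconst N + a) = mconst \<bar>N\<bar> + a"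
    "mconst (\<bar>N\<bar> - N) + (mconst N - a) = mconst \<bar>N\<bar> - a"
    by (simp_all add: mconst_diff)
  show ?thesis
    unfolding bounded_elems_def
    using add[OF c a(1)] add[OF c a(2)] abs_ge_zero[of N] unfolding eq by blast
qed

lemma bounded_mconst: "mconst c \<in> bounded_elems"
proof (rule bounded_elemsI)
  show "mconst \<bar>c\<bar> + mconst c \<in> T" "mconst \<bar>c\<bar> - mconst c \<in> T"
    by (simp_all flip: mconst_add mconst_diff add: const)
qed

lemma bounded_add: "a \<in> bounded_elems \<Longrightarrow> b \<in> bounded_elems \<Longrightarrow> a + b \<in> bounded_elems"
proof -
  assume "a \<in> bounded_elems" "b \<in> bounded_elems"
  then obtain M N where "mconst M + a \<in> T" "mconst M - a \<in> T" "mconst N + b \<in> T" "mconst N - b \<in> T"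
    unfolding bounded_elems_def by blast
  then have "(mconst M + a) + (mconst N + b) \<in> T" "(mconst M - a) + (mconst N - b) \<in> T"
    by (auto intro: add)
  then show ?thesis
    by (intro bounded_elemsI[of "M + N"]) (simp_all add: mconst_add algebra_simps)
qed

text \<open>
  \<open>2 (M N \<plusminus> a b) = (M + a) (N \<plusminus> b) + (M - a) (N \<mp> b)\<close>.
\<close>

lemma bounded_mult: "a \<in> bounded_elems \<Longrightarrow> b \<in> bounded_elems \<Longrightarrow> a * b \<in> bounded_elems"
proof -
  assume "a \<in> bounded_elems" "b \<in> bounded_elems"
  then obtain M N where T: "mconst M + a \<in> T" "mconst M - a \<in> T" "mconst N + b \<in> T" "mconst N - b \<in> T"
    unfolding bounded_elems_def by blast
  let ?h = "mconst (1 / 2)"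
  have h: "?h + ?h = 1"
    by (simp flip: mconst_add)
  have half: "?h * (c + c) = c" for c
    using arg_cong[OF h, of "\<lambda>z. z * c"] by (simp add: algebra_simps)
  have "mconst (M * N) + a * b = ?h * ((mconst M + a) * (mconst N + b) + (mconst M - a) * (mconst N - b))"
  proof -
    have "(mconst M + a) * (mconst N + b) + (mconst M - a) * (mconst N - b) =
       (mconst (M * N) + a * b) + (mconst (M * N) + a * b)"
      by (simp add: mconst_mult algebra_simps)
    then show ?thesis
      by (simp only: half)
  qed
  moreover have "mconst (M * N) - a * b = ?h * ((mconst M + a) * (mconst N - b) + (mconst M - a) * (mconst N + b))"
  proof -
    have "(mconst M + a) * (mconst N - b) + (mconst M - a) * (mconst N + b) =
       (mconst (M * N) - a * b) + (mconst (M * N) - a * b)"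
      by (simp add: mconst_mult algebra_simps)
    then show ?thesis
      by (simp only: half)
  qed
  ultimately show ?thesis
    using T by (intro bounded_elemsI[of "M * N"]) (auto intro!: mult add const)
qed

lemma mpoly_ring_bounded:
  assumes "\<And>j. j \<in> I \<Longrightarrow> mvar j \<in> bounded_elems"
  shows "mpoly_ring I \<subseteq> bounded_elems"
proof
  fix p assume "p \<in> mpoly_ring I"
  then show "p \<in> bounded_elems"
    by (induction p rule: mpoly_ring_induct) (auto intro: bounded_mconst bounded_add bounded_mult assms)
qed

end

text \<open>
  The function \<open>u (1 - u)\<^sup>m\<close> is nonpositive outside \<open>[0, 1]\<close> because \<open>m\<close> is odd; on \<open>[0, 1]\<close>, Bernoulli's inequality
  gives \<open>(1 - u)\<^sup>m (1 + m u) \<le> (1 - u\<^sup>2)\<^sup>m \<le> 1\<close>.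
\<close>

lemma mult_odd_power_le:
  fixes u :: real
  assumes "odd m"
  shows "u * (1 - u) ^ m \<le> 1 / real m"
proof -
  have m: "0 < real m"
    using assms by (cases m) auto
  consider "u < 0" | "0 \<le> u" "u \<le> 1" | "1 < u"
    by linarith
  then show ?thesis
  proof cases
    case 1
    then have "u * (1 - u) ^ m \<le> 0"
      by (intro mult_nonpos_nonneg) auto
    then show ?thesis
      using m by (smt (verit) divide_nonneg_pos)
  next
    case 2
    have "(1 - u) ^ m * (1 + real m * u) \<le> (1 - u) ^ m * (1 + u) ^ m"
      using 2 Bernoulli_inequality[of u m] by (intro mult_left_mono) auto
    also have "\<dots> = (1 - u * u) ^ m"
      by (simp add: power_mult_distrib[symmetric] algebra_simps)
    also have "\<dots> \<le> 1"
      using 2 by (intro power_le_one) (auto intro: mult_le_one)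
    finally have "(1 - u) ^ m * (1 + real m * u) \<le> 1" .
    moreover have "0 \<le> (1 - u) ^ m"
      using 2 by simp
    ultimately have "real m * (u * (1 - u) ^ m) \<le> 1"
      by (simp add: algebra_simps)
    then show ?thesis
      using m by (simp add: field_simps)
  next
    case 3
    then have "(1 - u) ^ m \<le> 0"
      using assms by (simp add: power_less_zero_eq less_imp_le)
    then have "u * (1 - u) ^ m \<le> 0"
      using 3 by (intro mult_nonneg_nonpos) auto
    then show ?thesis
      using m by (smt (verit) divide_nonneg_pos)
  qed
qed

lemma mult_power_le_neg:
  fixes u :: real
  assumes "0 < e" "u \<le> - e"
  shows "u * (1 - u) ^ m \<le> - (real m * e ^ 2)"
proof -
  have "1 + real m * e \<le> (1 + e) ^ m"
    using assms Bernoulli_inequality[of e m] by simp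
  also have "\<dots> \<le> (1 - u) ^ m"
    using assms by (intro power_mono) auto
  finally have "e * (real m * e) \<le> (- u) * (1 - u) ^ m"
    using assms by (intro mult_mono) auto
  then show ?thesis
    by (simp add: power2_eq_square algebra_simps)
qed

locale archimedean_semiring = poly_semiring +
  assumes fin: "finite I"
    and archimedean: "\<And>j. j \<in> I \<Longrightarrow> mvar j \<in> bounded_elems"
begin

definition nonneg_points :: "(nat \<Rightarrow> real) set" where
  "nonneg_points = {x. \<forall>g\<in>T. 0 \<le> meval x g}"

lemma common_bound:
  obtains N where "0 < N" "\<And>j. j \<in> I \<Longrightarrow> mconst N + mvar j \<in> T" "\<And>j. j \<in> I \<Longrightarrow> mconst N - mvar j \<in> T"
proof -
  have "\<forall>j\<in>I. \<exists>N. 0 \<le> N \<and> mconst N + mvar j \<in> T \<and> mconst N - mvar j \<in> T"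
    using archimedean unfolding bounded_elems_def by blast
  from bchoice[OF this] obtain b
    where b: "\<And>j. j \<in> I \<Longrightarrow> 0 \<le> b j \<and> mconst (b j) + mvar j \<in> T \<and> mconst (b j) - mvar j \<in> T"
    by blast
  define N where "N = (\<Sum>j\<in>I. b j) + 1"
  have le: "b j \<le> N" if "j \<in> I" for j
    using member_le_sum[of j I b] that b fin unfolding N_def by force
  have shift: "mconst N + p \<in> T" if "j \<in> I" "mconst (b j) + p \<in> T" for j p
  proof -
    have "mconst (N - b j) + (mconst (b j) + p) \<in> T"
      using le[OF that(1)] that(2) by (intro add[OF const[of "N - b j"] that(2)]) simp
    then show ?thesis
      by (simp add: mconst_diff)
  qed
  show ?thesis
  proof (rule that)
    show "0 < N"
      using b by (simp add: N_def add_nonneg_pos sum_nonneg)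
    show "mconst N + mvar j \<in> T" if "j \<in> I" for j
      using shift b that by blast
    show "mconst N - mvar j \<in> T" if "j \<in> I" for j
      using shift[of j "- mvar j"] b that by simp
  qed
qed

text \<open>
  The Bernstein polynomials are products of \<open>N + x\<^sub>j\<close>, \<open>N - x\<^sub>j\<close> and nonnegative constants.
\<close>

lemma positive_on_cube_mem:
  assumes N: "0 < N" "\<And>j. j \<in> I \<Longrightarrow> mconst N + mvar j \<in> T" "\<And>j. j \<in> I \<Longrightarrow> mconst N - mvar j \<in> T"
    and f: "f \<in> mpoly_ring I" and pos: "\<And>x. x \<in> coord_box I N \<Longrightarrow> 0 < meval x f"
  shows "f \<in> T"
proof -
  note bounds = N
  interpret cube I N
    using fin N by unfold_locales
  obtain d c where c: "f = (\<Sum>i\<in>indices d. mconst (c i) * bernstein d i)"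
    "\<And>i. i \<in> indices d \<Longrightarrow> 0 \<le> c i"
    using positive_on_cube_bernstein[OF f pos] by blast
  have "cvar j \<in> T" if "j \<in> I" for j
    unfolding cvar_def using bounds that by (intro mult const) auto
  moreover have "1 - cvar j \<in> T" if "j \<in> I" for j
  proof -
    have "mconst (1 / (2 * N)) * (mconst N - mvar j) \<in> T"
      using bounds that by (intro mult const) auto
    also have "mconst (1 / (2 * N)) * (mconst N - mvar j) = mconst (1 / (2 * N) * (2 * N)) - cvar j"
      unfolding cvar_def mconst_mult mult_2 mconst_add by (simp add: algebra_simps)
    finally show ?thesis
      using N by simp
  qed
  ultimately have "bernstein d i \<in> T" for i
    unfolding bernstein_def by (intro prod mult const power) auto
  then show ?thesis
    unfolding c(1) using c(2) by (intro sum mult const)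
qed

lemma bounded_below_one:
  assumes "g \<in> T"
  obtains s where "0 < s" "mconst s * g \<in> T" "1 - mconst s * g \<in> T"
proof -
  have "g \<in> bounded_elems"
    using mpoly_ring_bounded[OF archimedean] sub assms by blast
  then obtain N where N: "0 \<le> N" "mconst N - g \<in> T"
    unfolding bounded_elems_def by blast
  define s where "s = 1 / (N + 1)"
  have s: "0 < s" "s * (N + 1) = 1"
    using N by (simp_all add: s_def)
  have "mconst s * (1 + (mconst N - g)) \<in> T"
    using s N by (intro mult const add one) auto
  also have "mconst s * (1 + (mconst N - g)) = mconst (s * (N + 1)) - mconst s * g"
    by (simp add: mconst_mult mconst_add algebra_simps)
  finally have "1 - mconst s * g \<in> T"
    using s by simp
  moreover have "mconst s * g \<in> T"
    using s assms by (intro mult const) auto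
  ultimately show ?thesis
    using that s by blast
qed

text \<open>
  The Archimedean Positivstellensatz for semirings. The correction \<open>t\<close> makes \<open>f - t\<close> positive on the cube: where
  \<open>f\<close> is not safely positive, compactness provides finitely many \<open>g \<in> T\<close>, one of which is at most \<open>- \<delta>\<close>, and
  this one contributes at most \<open>- m \<delta>\<^sup>2\<close> to \<open>t\<close>.
\<close>

theorem positive_mem:
  assumes f: "f \<in> mpoly_ring I" and pos: "\<And>x. x \<in> nonneg_points \<Longrightarrow> 0 < meval x f"
  shows "f \<in> T"
proof -
  obtain N where N: "0 < N" "\<And>j. j \<in> I \<Longrightarrow> mconst N + mvar j \<in> T" "\<And>j. j \<in> I \<Longrightarrow> mconst N - mvar j \<in> T"
    using common_bound by blast
  let ?B = "coord_box I N"
  have closed: "closed {x. 0 \<le> meval x g}" for g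
    by (intro closed_Collect_le continuous_intros continuous_meval)
  have "nonneg_points = (\<Inter>g\<in>T. {x. 0 \<le> meval x g})"
    by (auto simp: nonneg_points_def)
  then have "compact (?B \<inter> nonneg_points)"
    using closed by (auto intro!: compact_Int_closed compact_coord_box)
  then obtain e where e: "0 < e" "\<And>x. x \<in> ?B \<inter> nonneg_points \<Longrightarrow> e \<le> meval x f"
    using continuous_pos_bounded_below[OF _ continuous_meval, of "?B \<inter> nonneg_points" f] pos by blast
  \<comment> \<open>The part of the cube where \<open>f\<close> needs the help of \<open>t\<close>; it avoids the nonnegativity points of \<open>T\<close>.\<close>
  define D where "D = ?B \<inter> {x. meval x f \<le> e / 2}"
  have D: "compact D"
    unfolding D_def
    by (intro compact_Int_closed compact_coord_box closed_Collect_le continuous_intros continuous_meval)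
  \<comment> \<open>Pairing \<open>g\<close> with a margin \<open>s\<close> makes the finite subcover yield a uniform \<open>\<delta>\<close>.\<close>
  define P where "P = {(g, s). g \<in> T \<and> 1 - g \<in> T \<and> 0 < (s :: real)}"
  have cover: "\<exists>(g, s)\<in>P. meval x g < - s" if x: "x \<in> D" for x
  proof -
    have "x \<notin> nonneg_points"
      using e x by (force simp: D_def)
    then obtain g where g: "g \<in> T" "meval x g < 0"
      by (auto simp: nonneg_points_def not_le)
    obtain s where s: "0 < s" "mconst s * g \<in> T" "1 - mconst s * g \<in> T"
      using bounded_below_one[OF g(1)] by blast
    \<comment> \<open>Half of the negative value leaves a strict inequality.\<close>
    define u where "u = - (s * meval x g)"
    have "0 < u"
      using s(1) g(2) by (simp add: u_def mult_pos_neg)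
    then have "(mconst s * g, u / 2) \<in> P" "meval x (mconst s * g) < - (u / 2)"
      using s g(2) by (auto simp: P_def u_def mult_pos_neg)
    then show ?thesis
      by blast
  qed
  have "\<exists>Q\<subseteq>P. finite Q \<and> D \<subseteq> (\<Union>(g, s)\<in>Q. {x. meval x g < - s})"
  proof (rule compactE_image[OF D, of P "\<lambda>(g, s). {x. meval x g < - s}"])
    show "open (case gs of (g, s) \<Rightarrow> {x. meval x g < - s})" for gs
      by (cases gs) (auto intro!: open_Collect_less continuous_intros continuous_meval)
    show "D \<subseteq> (\<Union>gs\<in>P. case gs of (g, s) \<Rightarrow> {x. meval x g < - s})"
      using cover by fastforce
  qed blast
  then obtain Q where Q: "Q \<subseteq> P" "finite Q" "D \<subseteq> (\<Union>(g, s)\<in>Q. {x. meval x g < - s})"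
    by blast
  define \<delta> where "\<delta> = Min (insert 1 (snd ` Q))"
  have \<delta>: "0 < \<delta>" "\<And>g s. (g, s) \<in> Q \<Longrightarrow> \<delta> \<le> s"
    using Q(1,2) by (auto simp: \<delta>_def P_def) (force intro: Min_le)
  define G where "G = fst ` Q"
  have G: "finite G" "\<And>g. g \<in> G \<Longrightarrow> g \<in> T \<and> 1 - g \<in> T"
    using Q by (auto simp: G_def P_def)
  obtain b where b: "0 \<le> b" "\<And>x. x \<in> ?B \<Longrightarrow> - b \<le> meval x f"
    using continuous_bounded_below[OF compact_coord_box continuous_meval] by blast
  let ?n = "real (card G)"
  obtain k :: nat where k: "2 * ?n / e + (b + ?n) / \<delta> ^ 2 < real k"
    using reals_Archimedean2 by blast
  \<comment> \<open>Odd, and large enough for both estimates below.\<close>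
  define m where "m = 2 * k + 1"
  have m: "odd m" "real k < real m" "0 < real m"
    by (simp_all add: m_def)
  have nonneg: "0 \<le> 2 * ?n / e" "0 \<le> (b + ?n) / \<delta> ^ 2"
    using e(1) b(1) by auto
  have m1: "?n / real m < e / 2"
  proof -
    have "2 * ?n / e < real m"
      using k nonneg m by linarith
    then show ?thesis
      using e(1) m by (simp add: field_simps)
  qed
  have m2: "b + ?n < real m * \<delta> ^ 2"
  proof -
    have "(b + ?n) / \<delta> ^ 2 < real m"
      using k nonneg m by linarith
    then show ?thesis
      using \<delta>(1) by (simp add: divide_less_eq)
  qed
  have m3: "?n / real m \<le> ?n"
    using m by (simp add: divide_le_eq) (simp add: m_def mult_le_cancel_left1)
  define t where "t = (\<Sum>g\<in>G. g * (1 - g) ^ m)"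
  have tT: "t \<in> T"
    unfolding t_def using G by (intro sum mult power) auto
  have le: "(\<Sum>g\<in>H. meval x g * (1 - meval x g) ^ m) \<le> ?n / real m" if "H \<subseteq> G" for H x
  proof -
    have "(\<Sum>g\<in>H. meval x g * (1 - meval x g) ^ m) \<le> (\<Sum>g\<in>H. 1 / real m)"
      by (intro sum_mono mult_odd_power_le m)
    also have "\<dots> \<le> ?n / real m"
      using card_mono[OF G(1) that] m by (simp add: divide_right_mono)
    finally show ?thesis .
  qed
  have "f - t \<in> T"
  proof (rule positive_on_cube_mem[OF N])
    show "f - t \<in> mpoly_ring I"
      using f tT sub by (intro mpoly_ring_diff) auto
    fix x assume x: "x \<in> ?B"
    have t: "meval x t = (\<Sum>g\<in>G. meval x g * (1 - meval x g) ^ m)"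
      by (simp add: t_def)
    show "0 < meval x (f - t)"
    proof (cases "x \<in> D")
      case True
      then obtain g s where g: "(g, s) \<in> Q" "meval x g < - s"
        using Q(3) by fastforce
      have gG: "g \<in> G"
        using g by (force simp: G_def)
      have "meval x g * (1 - meval x g) ^ m \<le> - (real m * \<delta> ^ 2)"
        using g \<delta>(2)[OF g(1)] by (intro mult_power_le_neg \<delta>(1)) auto
      moreover have "meval x t = meval x g * (1 - meval x g) ^ m +
          (\<Sum>g\<in>G - {g}. meval x g * (1 - meval x g) ^ m)"
        unfolding t using G(1) gG by (rule sum.remove)
      ultimately have "meval x t \<le> - (real m * \<delta> ^ 2) + ?n"
        using le[of "G - {g}" x] m3 by auto
      then show ?thesis
        using b(2)[OF x] m2 by simp
    next
      case False
      then have "e / 2 < meval x f"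
        using x by (auto simp: D_def)
      moreover have "meval x t \<le> ?n / real m"
        unfolding t by (rule le) simp
      ultimately show ?thesis
        unfolding meval_diff using m1 by linarith
    qed
  qed
  then have "(f - t) + t \<in> T"
    using tT by (rule add)
  then show ?thesis
    by simp
qed

end

section \<open>Kronecker cones\<close>

lemma sum_lessThan_mult:
  fixes F :: "nat \<Rightarrow> 'a::comm_monoid_add"
  shows "(\<Sum>a<d * D. F a) = (\<Sum>i<d. \<Sum>b<D. F (i * D + b))"
proof -
  have bij: "bij_betw (\<lambda>(i, b). i * D + b) ({..<d} \<times> {..<D}) {..<d * D}"
  proof (rule bij_betw_byWitness[where f' = "\<lambda>a. (a div D, a mod D)"])
    show "(\<lambda>(i, b). i * D + b) ` ({..<d} \<times> {..<D}) \<subseteq> {..<d * D}"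
    proof clarsimp
      fix i b assume "i < d" "b < D"
      then have "i * D + b < Suc i * D" "Suc i * D \<le> d * D"
        by (simp, intro mult_le_mono1) simp
      then show "i * D + b < d * D"
        by linarith
    qed
    show "(\<lambda>a. (a div D, a mod D)) ` {..<d * D} \<subseteq> {..<d} \<times> {..<D}"
    proof clarsimp
      fix a assume a: "a < d * D"
      then have "D > 0"
        by (cases D) auto
      then show "a div D < d \<and> a mod D < D"
        using a by (simp add: less_mult_imp_div_less)
    qed
  qed auto
  show ?thesis
    using sum.reindex_bij_betw[OF bij, of F]
    by (simp add: sum.cartesian_product case_prod_unfold)
qed

lemma mat_inner_eq_sum:
  assumes "A \<in> carrier_mat d d" "B \<in> carrier_mat d d"
  shows "mat_inner A B = (\<Sum>i<d. \<Sum>j<d. A $$ (i, j) * B $$ (i, j))"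
proof -
  have "mat_inner A B = (\<Sum>j<d. \<Sum>i<d. A $$ (i, j) * B $$ (i, j))"
    using assms by (simp add: mat_inner_def mat_trace_def scalar_prod_def atLeast0LessThan)
  then show ?thesis
    by (subst sum.swap) simp
qed

lemma mat_inner_mconst:
  assumes "L \<in> carrier_mat d d" "B \<in> carrier_mat d d"
  shows "mat_inner (map_mat mconst L) B = (\<Sum>i<d. \<Sum>j<d. mconst (L $$ (i, j)) * B $$ (i, j))"
  using assms by (subst mat_inner_eq_sum[of _ d]) auto

lemma psd_iff_sum:
  assumes "A \<in> carrier_mat d d"
  shows "psd A \<longleftrightarrow> sym_mat A \<and> (\<forall>v. 0 \<le> (\<Sum>i<d. \<Sum>j<d. v i * A $$ (i, j) * v j))"
proof -
  have form: "w \<bullet> (A *\<^sub>v w) = (\<Sum>i<d. \<Sum>j<d. w $ i * A $$ (i, j) * w $ j)" if "w \<in> carrier_vec d" for w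
    using assms that by (simp add: scalar_prod_def atLeast0LessThan sum_distrib_left mult.assoc)
  have fun_vec: "(\<Sum>i<d. \<Sum>j<d. v i * A $$ (i, j) * v j) = vec d v \<bullet> (A *\<^sub>v vec d v)" for v
    by (subst form) auto
  show ?thesis
  proof
    assume "psd A"
    then show "sym_mat A \<and> (\<forall>v. 0 \<le> (\<Sum>i<d. \<Sum>j<d. v i * A $$ (i, j) * v j))"
      using assms by (auto simp: psd_def fun_vec)
  next
    assume "sym_mat A \<and> (\<forall>v. 0 \<le> (\<Sum>i<d. \<Sum>j<d. v i * A $$ (i, j) * v j))"
    then show "psd A"
      using assms by (auto simp: psd_def form)
  qed
qed

lemma sym_mat_iff: "A \<in> carrier_mat d d \<Longrightarrow> sym_mat A \<longleftrightarrow> (\<forall>i<d. \<forall>j<d. A $$ (i, j) = A $$ (j, i))"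
  unfolding sym_mat_def by (auto simp: mat_eq_iff transpose_mat_def)

lemma psd_mats_iff:
  "A \<in> psd_mats d \<longleftrightarrow> A \<in> carrier_mat d d \<and> (\<forall>i<d. \<forall>j<d. A $$ (i, j) = A $$ (j, i)) \<and>
     (\<forall>v. 0 \<le> (\<Sum>i<d. \<Sum>j<d. v i * A $$ (i, j) * v j))"
  by (auto simp: psd_mats_def psd_iff_sum sym_mat_iff)

lemma psd_mats_0: "0\<^sub>m d d \<in> psd_mats d"
  by (auto simp: psd_mats_iff)

lemma psd_mats_add: "A \<in> psd_mats d \<Longrightarrow> B \<in> psd_mats d \<Longrightarrow> A + B \<in> psd_mats d"
  by (auto simp: psd_mats_iff distrib_left distrib_right sum.distrib)

lemma psd_mats_smult: "A \<in> psd_mats d \<Longrightarrow> 0 \<le> c \<Longrightarrow> c \<cdot>\<^sub>m A \<in> psd_mats d"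
proof -
  assume A: "A \<in> psd_mats d" and c: "0 \<le> c"
  have "(\<Sum>i<d. \<Sum>j<d. v i * (c \<cdot>\<^sub>m A) $$ (i, j) * v j) = c * (\<Sum>i<d. \<Sum>j<d. v i * A $$ (i, j) * v j)" for v
    using A by (auto simp: psd_mats_iff sum_distrib_left intro!: sum.cong)
  then show ?thesis
    using A c by (auto simp: psd_mats_iff)
qed

lemma psd_mats_1: "mat 1 1 (\<lambda>_. c) \<in> psd_mats 1 \<longleftrightarrow> 0 \<le> c"
  by (auto simp: psd_mats_iff mult.commute[of _ c] mult.assoc dest: spec[where x = "\<lambda>_. 1"])

definition outer :: "nat \<Rightarrow> (nat \<Rightarrow> real) \<Rightarrow> real mat" where
  "outer d v = mat d d (\<lambda>(i, j). v i * v j)"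

lemma outer_carrier: "outer d v \<in> carrier_mat d d"
  and outer_index: "i < d \<Longrightarrow> j < d \<Longrightarrow> outer d v $$ (i, j) = v i * v j"
  by (simp_all add: outer_def)

definition qform :: "(nat \<Rightarrow> real) \<Rightarrow> mpoly mat \<Rightarrow> mpoly" where
  "qform v U = (\<Sum>i<dim_row U. \<Sum>j<dim_row U. mconst (v i * v j) * U $$ (i, j))"

lemma kron_carrier:
  "A \<in> carrier_mat a b \<Longrightarrow> B \<in> carrier_mat c d \<Longrightarrow> kron A B \<in> carrier_mat (a * c) (b * d)"
  by (simp add: kron_def)

lemma kron_pow_carrier: "U \<in> carrier_mat d d \<Longrightarrow> kron_pow U k \<in> carrier_mat (d ^ k) (d ^ k)"
  by (induction k) (auto simp: kron_carrier)

lemma kron_index: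
  assumes "A \<in> carrier_mat a a" "B \<in> carrier_mat c c" "i < a" "b < c" "i' < a" "b' < c"
  shows "kron A B $$ (i * c + b, i' * c + b') = A $$ (i, i') * B $$ (b, b')"
proof -
  have "i * c + b < a * c" if "i < a" "b < c" for i b :: nat
  proof -
    have "i * c + b < Suc i * c" "Suc i * c \<le> a * c"
      using that by (simp, intro mult_le_mono1) simp
    then show ?thesis
      by linarith
  qed
  then show ?thesis
    using assms by (simp add: kron_def)
qed

text \<open>
  The quadratic form of \<open>v v\<^sup>T \<otimes> L\<close> at \<open>x\<close> is that of \<open>L\<close> at the contraction \<open>y\<^sub>b = \<Sum>\<^sub>i v\<^sub>i x\<^sub>(\<^sub>i\<^sub>,\<^sub>b\<^sub>)\<close>.
\<close>

lemma outer_kron_psd: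
  assumes L: "L \<in> psd_mats D"
  shows "kron (outer d v) L \<in> psd_mats (d * D)"
proof -
  have Lc: "L \<in> carrier_mat D D" and Oc: "outer d v \<in> carrier_mat d d"
    using L by (auto simp: psd_mats_def outer_carrier)
  have sym: "kron (outer d v) L $$ (a, a') = kron (outer d v) L $$ (a', a)" if "a < d * D" "a' < d * D" for a a'
  proof -
    have D: "D > 0"
      using that by (cases D) auto
    then have *: "a div D < d" "a' div D < d" "a mod D < D" "a' mod D < D"
      using that by (auto simp: less_mult_imp_div_less)
    then show ?thesis
      using that L carrier_matD[OF Lc] carrier_matD[OF outer_carrier]
      by (simp add: kron_def outer_index psd_mats_iff)
  qed
  have "0 \<le> (\<Sum>a<d * D. \<Sum>a'<d * D. x a * kron (outer d v) L $$ (a, a') * x a')" for x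
  proof -
    define y where "y b = (\<Sum>i<d. v i * x (i * D + b))" for b
    have "(\<Sum>a<d * D. \<Sum>a'<d * D. x a * kron (outer d v) L $$ (a, a') * x a') =
      (\<Sum>i<d. \<Sum>b<D. \<Sum>i'<d. \<Sum>b'<D. (v i * x (i * D + b)) * L $$ (b, b') * (v i' * x (i' * D + b')))"
      unfolding sum_lessThan_mult
      by (intro sum.cong refl) (simp add: kron_index[OF Oc Lc] outer_index)
    also have "\<dots> = (\<Sum>b<D. \<Sum>i<d. \<Sum>b'<D. \<Sum>i'<d. (v i * x (i * D + b)) * L $$ (b, b') * (v i' * x (i' * D + b')))"
      by (subst sum.swap, subst (3) sum.swap) (rule refl)
    also have "\<dots> = (\<Sum>b<D. \<Sum>b'<D. \<Sum>i<d. \<Sum>i'<d. (v i * x (i * D + b)) * L $$ (b, b') * (v i' * x (i' * D + b')))"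
      by (subst (2) sum.swap) (rule refl)
    also have "\<dots> = (\<Sum>b<D. \<Sum>b'<D. y b * L $$ (b, b') * y b')"
      unfolding y_def
      by (intro sum.cong refl, subst sum.swap) (simp add: sum_distrib_left sum_distrib_right)
    also have "\<dots> \<ge> 0"
      using L by (simp add: psd_mats_iff)
    finally show ?thesis .
  qed
  then show ?thesis
    using sym kron_carrier[OF Oc Lc] by (auto simp: psd_mats_iff)
qed

lemma qform_mult_mat_inner:
  assumes U: "U \<in> carrier_mat d d" and W: "W \<in> carrier_mat D D" and L: "L \<in> carrier_mat D D"
  shows "qform v U * mat_inner (map_mat mconst L) W =
     mat_inner (map_mat mconst (kron (outer d v) L)) (kron U W)"
proof -
  note Oc = outer_carrier[of d v]
  have "mat_inner (map_mat mconst (kron (outer d v) L)) (kron U W) =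
     (\<Sum>i<d. \<Sum>b<D. \<Sum>i'<d. \<Sum>b'<D.
        (mconst (v i * v i') * U $$ (i, i')) * (mconst (L $$ (b, b')) * W $$ (b, b')))"
    unfolding mat_inner_mconst[OF kron_carrier[OF Oc L] kron_carrier[OF U W]] sum_lessThan_mult
    by (intro sum.cong refl)
      (simp add: kron_index[OF Oc L] kron_index[OF U W] outer_index mconst_mult mult.assoc mult.left_commute)
  also have "\<dots> = (\<Sum>i<d. \<Sum>i'<d. \<Sum>b<D. \<Sum>b'<D.
        (mconst (v i * v i') * U $$ (i, i')) * (mconst (L $$ (b, b')) * W $$ (b, b')))"
    by (subst (2) sum.swap) (rule refl)
  also have "\<dots> = qform v U * mat_inner (map_mat mconst L) W"
    unfolding mat_inner_mconst[OF L W] qform_def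
    by (simp only: sum_distrib_right carrier_matD[OF U]) (simp only: sum_distrib_left)
  finally show ?thesis ..
qed

text \<open>
  Treating the constant as the \<open>k = 0\<close> term makes all closure properties uniform in \<open>k\<close>.
\<close>

lemma kron_cone_eq:
  assumes U: "U \<in> carrier_mat d d"
  shows "kron_cone U = {\<Sum>k\<le>m. mat_inner (map_mat mconst (L k)) (kron_pow U k) | m L.
     \<forall>k. L k \<in> psd_mats (d ^ k)}" (is "_ = ?R")
proof (intro equalityI subsetI)
  have zero: "mat_inner (map_mat mconst L) (kron_pow U 0) = mconst (L $$ (0, 0))"
    if "L \<in> carrier_mat 1 1" for L
    using that by (subst mat_inner_mconst[of _ 1]) auto
  have split: "(\<Sum>k\<le>m. f k) = f 0 + (\<Sum>k=1..m. f k)" for f :: "nat \<Rightarrow> mpoly" and m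
    by (simp add: atMost_atLeast0 sum.atLeast_Suc_atMost)
  {
    fix p assume "p \<in> kron_cone U"
    then obtain m c L where p: "p = mconst c + (\<Sum>k=1..m. mat_inner (map_mat mconst (L k)) (kron_pow U k))"
      and c: "0 \<le> c" and L: "\<And>k. k \<in> {1..m} \<Longrightarrow> L k \<in> psd_mats (d ^ k)"
      using U unfolding kron_cone_def by fastforce
    define L' where "L' k = (if k = 0 then mat 1 1 (\<lambda>_. c) else if k \<le> m then L k else 0\<^sub>m (d ^ k) (d ^ k))" for k
    have "L' k \<in> psd_mats (d ^ k)" for k
      using c L[of k] psd_mats_1[of c] psd_mats_0[of "d ^ k"] by (auto simp: L'_def)
    moreover have "p = (\<Sum>k\<le>m. mat_inner (map_mat mconst (L' k)) (kron_pow U k))"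
      unfolding p split using zero[of "L' 0"] by (simp add: L'_def)
    ultimately show "p \<in> ?R"
      by blast
  }
  {
    fix p assume "p \<in> ?R"
    then obtain m L where p: "p = (\<Sum>k\<le>m. mat_inner (map_mat mconst (L k)) (kron_pow U k))"
      and L: "\<And>k. L k \<in> psd_mats (d ^ k)"
      by blast
    have L0: "L 0 \<in> psd_mats 1"
      using L[of 0] by simp
    then have L0': "L 0 \<in> carrier_mat 1 1"
      by (simp add: psd_mats_def)
    then have "L 0 = mat 1 1 (\<lambda>_. L 0 $$ (0, 0))"
      by (intro eq_matI) auto
    then have "0 \<le> L 0 $$ (0, 0)"
      using L0 psd_mats_1 by metis
    then show "p \<in> kron_cone U"
      unfolding p split zero[OF L0'] kron_cone_def using L U by blast
  }
qed

lemma kron_cone_add: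
  assumes U: "U \<in> carrier_mat d d" and a: "a \<in> kron_cone U" and b: "b \<in> kron_cone U"
  shows "a + b \<in> kron_cone U"
proof -
  let ?t = "\<lambda>L k. mat_inner (map_mat mconst (L k)) (kron_pow U k)"
  have pad: "\<exists>L. (\<forall>k. L k \<in> psd_mats (d ^ k)) \<and> (\<forall>m'\<ge>m. p = (\<Sum>k\<le>m'. ?t L k))"
    if L: "\<forall>k. L k \<in> psd_mats (d ^ k)" "p = (\<Sum>k\<le>m. ?t L k)" for p m L
  proof (intro exI[of _ "\<lambda>k. if k \<le> m then L k else 0\<^sub>m (d ^ k) (d ^ k)"] conjI allI impI)
    fix m' assume "m \<le> m'"
    then have "(\<Sum>k\<le>m'. ?t (\<lambda>k. if k \<le> m then L k else 0\<^sub>m (d ^ k) (d ^ k)) k) =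
      (\<Sum>k\<le>m. ?t (\<lambda>k. if k \<le> m then L k else 0\<^sub>m (d ^ k) (d ^ k)) k)"
      using mat_inner_mconst[OF zero_carrier_mat kron_pow_carrier[OF U]]
      by (intro sum.mono_neutral_right) auto
    then show "p = (\<Sum>k\<le>m'. ?t (\<lambda>k. if k \<le> m then L k else 0\<^sub>m (d ^ k) (d ^ k)) k)"
      using L by simp
  qed (use L psd_mats_0 in auto)
  obtain m1 L1 where 1: "\<forall>k. L1 k \<in> psd_mats (d ^ k)" "\<forall>m'\<ge>m1. a = (\<Sum>k\<le>m'. ?t L1 k)"
    using a pad unfolding kron_cone_eq[OF U] by blast
  obtain m2 L2 where 2: "\<forall>k. L2 k \<in> psd_mats (d ^ k)" "\<forall>m'\<ge>m2. b = (\<Sum>k\<le>m'. ?t L2 k)"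
    using b pad unfolding kron_cone_eq[OF U] by blast
  let ?m = "max m1 m2"
  have "?t L1 k + ?t L2 k = ?t (\<lambda>k. L1 k + L2 k) k" for k
  proof -
    have "L1 k \<in> carrier_mat (d ^ k) (d ^ k)" "L2 k \<in> carrier_mat (d ^ k) (d ^ k)"
      using 1 2 by (auto simp: psd_mats_def)
    then show ?thesis
      using kron_pow_carrier[OF U, of k]
      by (simp add: mat_inner_mconst[where d = "d ^ k"] mconst_add distrib_right sum.distrib)
  qed
  then have "a + b = (\<Sum>k\<le>?m. ?t (\<lambda>k. L1 k + L2 k) k)"
    using 1(2)[rule_format, of ?m] 2(2)[rule_format, of ?m] by (simp flip: sum.distrib)
  then show ?thesis
    unfolding kron_cone_eq[OF U] using 1(1) 2(1)
    by (intro CollectI exI[of _ ?m] exI[of _ "\<lambda>k. L1 k + L2 k"] conjI) (simp_all add: psd_mats_add)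
qed

lemma kron_cone_mconst: "0 \<le> c \<Longrightarrow> mconst c \<in> kron_cone U"
  unfolding kron_cone_def by (rule CollectI, rule exI[of _ 0]) auto

lemma kron_cone_smult:
  assumes U: "U \<in> carrier_mat d d" and a: "a \<in> kron_cone U" and c: "0 \<le> c"
  shows "mconst c * a \<in> kron_cone U"
proof -
  obtain m L where a: "a = (\<Sum>k\<le>m. mat_inner (map_mat mconst (L k)) (kron_pow U k))"
    and L: "\<And>k. L k \<in> psd_mats (d ^ k)"
    using a unfolding kron_cone_eq[OF U] by blast
  have "mconst c * mat_inner (map_mat mconst (L k)) (kron_pow U k) =
     mat_inner (map_mat mconst (c \<cdot>\<^sub>m L k)) (kron_pow U k)" for k
  proof -
    have "L k \<in> carrier_mat (d ^ k) (d ^ k)"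
      using L by (auto simp: psd_mats_def)
    then show ?thesis
      using kron_pow_carrier[OF U, of k]
      by (simp add: mat_inner_mconst[where d = "d ^ k"] mconst_mult sum_distrib_left mult.assoc)
  qed
  then have "mconst c * a = (\<Sum>k\<le>m. mat_inner (map_mat mconst (c \<cdot>\<^sub>m L k)) (kron_pow U k))"
    by (simp add: a sum_distrib_left)
  then show ?thesis
    unfolding kron_cone_eq[OF U] using psd_mats_smult[OF L c]
    by (intro CollectI exI[of _ m] exI[of _ "\<lambda>k. c \<cdot>\<^sub>m L k"]) simp
qed

lemma kron_cone_qform_mult:
  assumes U: "U \<in> carrier_mat d d" and a: "a \<in> kron_cone U"
  shows "qform v U * a \<in> kron_cone U"
proof -
  obtain m L where a: "a = (\<Sum>k\<le>m. mat_inner (map_mat mconst (L k)) (kron_pow U k))"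
    and L: "\<And>k. L k \<in> psd_mats (d ^ k)"
    using a unfolding kron_cone_eq[OF U] by blast
  define L' where "L' k = (case k of 0 \<Rightarrow> 0\<^sub>m 1 1 | Suc k \<Rightarrow> kron (outer d v) (L k))" for k
  have "L' k \<in> psd_mats (d ^ k)" for k
    using psd_mats_0[of 1] outer_kron_psd[OF L] by (auto simp: L'_def split: nat.split)
  moreover have "qform v U * a = (\<Sum>k\<le>Suc m. mat_inner (map_mat mconst (L' k)) (kron_pow U k))"
  proof -
    have Lc: "L k \<in> carrier_mat (d ^ k) (d ^ k)" for k
      using L by (auto simp: psd_mats_def)
    have "qform v U * a = (\<Sum>k\<le>m. mat_inner (map_mat mconst (L' (Suc k))) (kron_pow U (Suc k)))"
      by (simp add: a sum_distrib_left L'_def qform_mult_mat_inner[OF U kron_pow_carrier[OF U] Lc])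
    also have "\<dots> = (\<Sum>k\<le>Suc m. mat_inner (map_mat mconst (L' k)) (kron_pow U k))"
    proof -
      have "mat_inner (map_mat mconst (L' 0)) (kron_pow U 0) = 0"
        by (subst mat_inner_mconst[of _ 1]) (auto simp: L'_def)
      then show ?thesis
        by (simp add: sum.atMost_Suc_shift del: sum.atMost_Suc kron_pow.simps)
    qed
    finally show ?thesis .
  qed
  ultimately show ?thesis
    unfolding kron_cone_eq[OF U] by blast
qed

lemma kron_cone_subset_subring:
  assumes U: "U \<in> carrier_mat d d"
    and const: "\<And>c. mconst c \<in> R" and add: "\<And>a b. a \<in> R \<Longrightarrow> b \<in> R \<Longrightarrow> a + b \<in> R"
    and mult: "\<And>a b. a \<in> R \<Longrightarrow> b \<in> R \<Longrightarrow> a * b \<in> R"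
    and entries: "elements_mat U \<subseteq> R"
  shows "kron_cone U \<subseteq> R"
proof
  fix p assume "p \<in> kron_cone U"
  then obtain m L where p: "p = (\<Sum>k\<le>m. mat_inner (map_mat mconst (L k)) (kron_pow U k))"
    and L: "\<And>k. L k \<in> psd_mats (d ^ k)"
    unfolding kron_cone_eq[OF U] by blast
  have R0: "0 \<in> R" and R1: "1 \<in> R"
    using const[of 0] const[of 1] by simp_all
  have sum: "sum f A \<in> R" if "\<And>a. a \<in> A \<Longrightarrow> f a \<in> R" for f :: "nat \<Rightarrow> mpoly" and A
    using that by (induction A rule: infinite_finite_induct) (auto intro: R0 add)
  have pow: "kron_pow U k $$ (i, j) \<in> R" if "i < d ^ k" "j < d ^ k" for k i j
    using that
  proof (induction k arbitrary: i j)
    case 0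
    then show ?case by (simp add: R1)
  next
    case (Suc k)
    have pos: "d ^ k > 0"
      using Suc.prems(1) by (cases "d ^ k") auto
    then have *: "i div d ^ k < d" "j div d ^ k < d" "i mod d ^ k < d ^ k" "j mod d ^ k < d ^ k"
      using Suc.prems by (auto intro!: less_mult_imp_div_less)
    have "U $$ (i div d ^ k, j div d ^ k) \<in> R"
      using entries U * by auto
    moreover have "kron_pow U (Suc k) $$ (i, j) =
       U $$ (i div d ^ k, j div d ^ k) * kron_pow U k $$ (i mod d ^ k, j mod d ^ k)"
      using Suc.prems U kron_pow_carrier[OF U, of k] by (simp add: kron_def)
    ultimately show ?case
      using mult Suc.IH * by metis
  qed
  have "mat_inner (map_mat mconst (L k)) (kron_pow U k) \<in> R" for k
  proof -
    have "L k \<in> carrier_mat (d ^ k) (d ^ k)"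
      using L by (auto simp: psd_mats_def)
    then show ?thesis
      using kron_pow_carrier[OF U, of k]
      by (auto simp: mat_inner_mconst[where d = "d ^ k"] intro!: sum mult const pow)
  qed
  then show "p \<in> R"
    unfolding p by (intro sum)
qed

section \<open>Multipliers\<close>

lemma qform_mpoly_ring:
  assumes "U \<in> carrier_mat d d" "elements_mat U \<subseteq> mpoly_ring I"
  shows "qform v U \<in> mpoly_ring I"
  unfolding qform_def using assms by (intro mpoly_ring_sum mpoly_ring_mult) auto

lemma meval_qform:
  "U \<in> carrier_mat d d \<Longrightarrow> meval x (qform v U) = (\<Sum>i<d. \<Sum>j<d. v i * eval_mat x U $$ (i, j) * v j)"
  by (simp add: qform_def eval_mat_def mult_ac)

lemma psd_eval_iff:
  assumes "U \<in> carrier_mat d d" "sym_mat U"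
  shows "psd (eval_mat x U) \<longleftrightarrow> (\<forall>v. 0 \<le> meval x (qform v U))"
proof -
  have E: "eval_mat x U \<in> carrier_mat d d"
    using assms by (simp add: eval_mat_def)
  have "sym_mat (eval_mat x U)"
    using assms unfolding sym_mat_iff[OF E] sym_mat_iff[OF assms(1)] by (auto simp: eval_mat_def)
  then show ?thesis
    using psd_iff_sum[OF E] meval_qform[OF assms(1)] by simp
qed

text \<open>
  Passing to multipliers produces a semiring inside the cone, and membership needs no normal form: it
  suffices that \<open>v\<^sup>T U v\<close> multiplies the cone into itself.
\<close>

definition multipliers :: "nat set \<Rightarrow> mpoly mat \<Rightarrow> mpoly set" where
  "multipliers I U = {t \<in> mpoly_ring I. \<forall>h\<in>kron_cone U. t * h \<in> kron_cone U}"

lemma poly_semiring_multipliers: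
  assumes U: "U \<in> carrier_mat d d"
  shows "poly_semiring (multipliers I U) I"
proof
  show "multipliers I U \<subseteq> mpoly_ring I"
    by (auto simp: multipliers_def)
  show "mconst c \<in> multipliers I U" if "0 \<le> c" for c
    using kron_cone_smult[OF U _ that] by (simp add: multipliers_def)
  show "a + b \<in> multipliers I U" if "a \<in> multipliers I U" "b \<in> multipliers I U" for a b
    using that kron_cone_add[OF U] by (auto simp: multipliers_def mpoly_ring_add distrib_right)
  show "a * b \<in> multipliers I U" if "a \<in> multipliers I U" "b \<in> multipliers I U" for a b
    using that by (auto simp: multipliers_def mpoly_ring_mult mult.assoc)
qed

lemma multipliers_subset: "multipliers I U \<subseteq> kron_cone U"
  using kron_cone_mconst[of 1 U] by (force simp: multipliers_def)

lemma qform_multiplier: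
  assumes "U \<in> carrier_mat d d" "elements_mat U \<subseteq> mpoly_ring I"
  shows "qform v U \<in> multipliers I U"
  using qform_mpoly_ring[OF assms] kron_cone_qform_mult[OF assms(1)] by (simp add: multipliers_def)

text \<open>
  Since every \<open>v\<^sup>T U v\<close> is a multiplier, \<open>U(x)\<close> is positive semidefinite wherever all multipliers are
  nonnegative.
\<close>

theorem kron_cone_positivstellensatz:
  assumes U: "U \<in> carrier_mat d d" "sym_mat U" "elements_mat U \<subseteq> mpoly_ring I" and I: "finite I"
    and bounded: "\<And>j. j \<in> I \<Longrightarrow> mvar j \<in> poly_semiring.bounded_elems (multipliers I U)"
    and f: "f \<in> mpoly_ring I" and pos: "\<And>x. psd (eval_mat x U) \<Longrightarrow> 0 < meval x f"
  shows "f \<in> kron_cone U"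
proof -
  interpret poly_semiring "multipliers I U" I
    using U(1) by (rule poly_semiring_multipliers)
  interpret archimedean_semiring "multipliers I U" I
    using I bounded by unfold_locales
  have "f \<in> multipliers I U"
  proof (rule positive_mem[OF f])
    fix x assume "x \<in> nonneg_points"
    then have "psd (eval_mat x U)"
      using qform_multiplier[OF U(1,3)] by (simp add: psd_eval_iff[OF U(1,2)] nonneg_points_def)
    then show "0 < meval x f"
      by (rule pos)
  qed
  then show ?thesis
    using multipliers_subset by blast
qed

section \<open>Matrices of constant trace\<close>

lemma qform_two_coords:
  fixes s :: real
  assumes U: "U \<in> carrier_mat d d" and ij: "i < d" "j < d"
  shows "qform (\<lambda>k. (if k = i then 1 else 0) + (if k = j then s else 0)) U =
    U $$ (i, i) + mconst s * U $$ (i, j) + mconst s * (U $$ (j, i) + mconst s * U $$ (j, j))"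
proof -
  define w where "w k = (if k = i then 1 else 0) + (if k = j then mconst s else 0)" for k
  have pick: "(\<Sum>k<d. w k * F k) = F i + mconst s * F j" for F
  proof -
    have "w k * F k = (if k = i then F k else 0) + (if k = j then mconst s * F k else 0)" for k
      by (simp add: w_def distrib_right)
    then show ?thesis
      using ij by (simp add: sum.distrib)
  qed
  have w: "mconst ((if k = i then 1 else 0) + (if k = j then s else 0)) = w k" for k
    by (simp add: w_def mconst_add)
  have "qform (\<lambda>k. (if k = i then 1 else 0) + (if k = j then s else 0)) U =
     (\<Sum>k<d. w k * (\<Sum>l<d. w l * U $$ (k, l)))"
    unfolding qform_def mconst_mult w using U by (simp add: sum_distrib_left mult.assoc)
  also have "\<dots> = (U $$ (i, i) + mconst s * U $$ (i, j)) + mconst s * (U $$ (j, i) + mconst s * U $$ (j, j))"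
    by (simp only: pick)
  finally show ?thesis .
qed

text \<open>
  The diagonal entries are multipliers with constant sum, hence bounded. Off the diagonal,
  \<open>u\<^sub>i\<^sub>i + u\<^sub>j\<^sub>j \<plusminus> 2 u\<^sub>i\<^sub>j\<close> is the form at \<open>e\<^sub>i \<plusminus> e\<^sub>j\<close>, and adding the remaining diagonal entries gives
  \<open>c \<plusminus> 2 u\<^sub>i\<^sub>j\<close>.
\<close>

lemma bounded_of_constant_trace:
  assumes U: "U \<in> carrier_mat d d" "sym_mat U" "elements_mat U \<subseteq> mpoly_ring I"
    and trace: "(\<Sum>i<d. U $$ (i, i)) = mconst c"
    and gen: "mpoly_ring I \<subseteq> {a - b | a b. a \<in> kron_cone U \<and> b \<in> kron_cone U}"
  shows "mpoly_ring I \<subseteq> poly_semiring.bounded_elems (multipliers I U)"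
proof -
  interpret poly_semiring "multipliers I U" I
    using U(1) by (rule poly_semiring_multipliers)
  have diag: "U $$ (i, i) \<in> multipliers I U" if "i < d" for i
    using qform_multiplier[OF U(1,3)] qform_two_coords[OF U(1) that that, of 0] by simp metis
  have rest: "mconst c - (\<Sum>k\<in>S. U $$ (k, k)) \<in> multipliers I U" if "S \<subseteq> {..<d}" for S
  proof -
    have "mconst c - (\<Sum>k\<in>S. U $$ (k, k)) = (\<Sum>k\<in>{..<d} - S. U $$ (k, k))"
      using that by (simp add: sum_diff trace)
    then show ?thesis
      using diag by (auto intro: sum)
  qed
  have entry: "U $$ (i, j) \<in> bounded_elems" if ij: "i < d" "j < d" for i j
  proof (cases "i = j")
    case True
    have "mconst c + U $$ (i, i) \<in> multipliers I U"
      using rest[of "{}"] diag[OF ij(1)] by (auto intro: add)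
    moreover have "mconst c - U $$ (i, i) \<in> multipliers I U"
      using rest[of "{i}"] ij by simp
    ultimately show ?thesis
      unfolding True[symmetric] by (rule bounded_elemsI)
  next
    case False
    have sym: "U $$ (j, i) = U $$ (i, j)"
      using U(2) ij unfolding sym_mat_iff[OF U(1)] by simp
    have "mconst c + mconst s * (U $$ (i, j) + U $$ (i, j)) \<in> multipliers I U" if "s * s = 1" for s
    proof -
      have ss: "mconst s * (mconst s * U $$ (j, j)) = U $$ (j, j)"
        using that by (simp flip: mult.assoc mconst_mult)
      have "U $$ (i, i) + U $$ (j, j) + mconst s * (U $$ (i, j) + U $$ (i, j)) \<in> multipliers I U"
        using qform_multiplier[OF U(1,3), of "\<lambda>k. (if k = i then 1 else 0) + (if k = j then s else 0)"]
        unfolding qform_two_coords[OF U(1) ij] distrib_left ss by (simp only: sym add_ac)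
      moreover have "mconst c - (U $$ (i, i) + U $$ (j, j)) \<in> multipliers I U"
        using rest[of "{i, j}"] ij False by simp
      ultimately have "(U $$ (i, i) + U $$ (j, j) + mconst s * (U $$ (i, j) + U $$ (i, j))) +
          (mconst c - (U $$ (i, i) + U $$ (j, j))) \<in> multipliers I U"
        by (rule add)
      then show ?thesis
        by (simp add: algebra_simps)
    qed
    from this[of 1] this[of "-1"] have "U $$ (i, j) + U $$ (i, j) \<in> bounded_elems"
      by (intro bounded_elemsI[of c]) (simp_all add: mconst_uminus)
    then have "mconst (1 / 2) * (U $$ (i, j) + U $$ (i, j)) \<in> bounded_elems"
      by (intro bounded_mult bounded_mconst)
    moreover have "mconst (1 / 2) * (U $$ (i, j) + U $$ (i, j)) = mconst (1 / 2 + 1 / 2) * U $$ (i, j)"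
      by (simp only: mconst_add distrib_left distrib_right)
    ultimately have "mconst (1 / 2 + 1 / 2) * U $$ (i, j) \<in> bounded_elems"
      by (simp only:)
    then show ?thesis
      by simp
  qed
  have cone: "kron_cone U \<subseteq> bounded_elems"
    using entry U(1) by (intro kron_cone_subset_subring[OF U(1) bounded_mconst bounded_add bounded_mult]) auto
  have "a - b \<in> bounded_elems" if "a \<in> kron_cone U" "b \<in> kron_cone U" for a b
  proof -
    have "a + mconst (- 1) * b \<in> bounded_elems"
      using that cone by (intro bounded_add bounded_mult bounded_mconst) auto
    then show ?thesis
      by (simp add: mconst_uminus)
  qed
  then show ?thesis
    using gen by blast
qed

section \<open>Positive affine functions\<close>

definition coord_space :: "nat set \<Rightarrow> (nat \<Rightarrow> real) set" where
  "coord_space J = {v. \<forall>j. j \<notin> J \<longrightarrow> v j = 0}"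

text \<open>
  Extension by one coordinate at a time. The admissible values for the new coefficient \<open>a\<close> are those between
  \<open>?L w' - \<phi> (w' - e\<^sub>k)\<close> and \<open>\<phi> (w + e\<^sub>k) - ?L w\<close>, and subadditivity shows that such values exist. The dimension
  is a set of indices because it varies with the block.
\<close>

lemma finite_dim_hahn_banach:
  fixes \<phi> :: "(nat \<Rightarrow> real) \<Rightarrow> real"
  assumes J: "finite J"
    and subadd: "\<And>v w. \<phi> (\<lambda>j. v j + w j) \<le> \<phi> v + \<phi> w"
    and homog: "\<And>c v. 0 < c \<Longrightarrow> \<phi> (\<lambda>j. c * v j) \<le> c * \<phi> v"
    and zero: "0 \<le> \<phi> (\<lambda>_. 0)"
  shows "\<exists>l. \<forall>w. (\<forall>j. j \<notin> J \<longrightarrow> w j = 0) \<longrightarrow> (\<Sum>j\<in>J. l j * w j) \<le> \<phi> w"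
  using J
proof (induction J rule: finite_induct)
  case empty
  have "0 \<le> \<phi> w" if "\<forall>j. w j = 0" for w
  proof -
    have "w = (\<lambda>_. 0)"
      using that by auto
    then show ?thesis
      using zero by simp
  qed
  then show ?case
    by simp
next
  case (insert k J)
  then obtain l where l: "\<And>w. (\<forall>j. j \<notin> J \<longrightarrow> w j = 0) \<Longrightarrow> (\<Sum>j\<in>J. l j * w j) \<le> \<phi> w"
    by blast
  let ?L = "\<lambda>w. \<Sum>j\<in>J. l j * w j"
  define a where "a = (INF w\<in>coord_space J. \<phi> (w(k := 1)) - ?L w)"
  have sep: "?L w' - \<phi> (w'(k := -1)) \<le> \<phi> (w(k := 1)) - ?L w" if "w \<in> coord_space J" "w' \<in> coord_space J" for w w'
  proof -
    have "?L w + ?L w' = ?L (\<lambda>j. w j + w' j)"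
      by (simp add: distrib_left sum.distrib)
    also have "\<dots> \<le> \<phi> (\<lambda>j. w j + w' j)"
      using that by (intro l) (auto simp: coord_space_def)
    also have "(\<lambda>j. w j + w' j) = (\<lambda>j. (w(k := 1)) j + (w'(k := -1)) j)"
      using that insert.hyps(2) by (auto simp: coord_space_def)
    also have "\<phi> \<dots> \<le> \<phi> (w(k := 1)) + \<phi> (w'(k := -1))"
      by (rule subadd)
    finally show ?thesis
      by linarith
  qed
  have zero_supp: "(\<lambda>_. 0) \<in> coord_space J"
    by (simp add: coord_space_def)
  have bdd: "bdd_below ((\<lambda>w. \<phi> (w(k := 1)) - ?L w) ` coord_space J)"
    by (rule bdd_belowI2) (rule sep[OF _ zero_supp])
  have upper: "a \<le> \<phi> (w(k := 1)) - ?L w" if "w \<in> coord_space J" for w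
    unfolding a_def using bdd that by (rule cINF_lower)
  have lower: "?L w - \<phi> (w(k := -1)) \<le> a" if "w \<in> coord_space J" for w
  proof -
    have "?L w - \<phi> (w(k := -1)) \<le> (INF u\<in>coord_space J. \<phi> (u(k := 1)) - ?L u)"
    proof (rule cINF_greatest)
      show "coord_space J \<noteq> {}"
        using zero_supp by blast
      show "?L w - \<phi> (w(k := -1)) \<le> \<phi> (u(k := 1)) - ?L u" if "u \<in> coord_space J" for u
        using sep[OF that \<open>w \<in> coord_space J\<close>] .
    qed
    then show ?thesis
      by (simp only: a_def)
  qed
  have "(\<Sum>j\<in>insert k J. (l(k := a)) j * w j) \<le> \<phi> w" if w: "\<forall>j. j \<notin> insert k J \<longrightarrow> w j = 0" for w
  proof -
    have sum: "(\<Sum>j\<in>insert k J. (l(k := a)) j * w j) = a * w k + ?L w"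
      using insert.hyps by (simp, intro sum.cong) auto
    have part: "?L (\<lambda>j. if j = k then 0 else c * w j) = c * ?L w" for c
      unfolding sum_distrib_left using insert.hyps(2) by (intro sum.cong) auto
    consider "w k = 0" | "0 < w k" | "w k < 0"
      by linarith
    then show ?thesis
    proof cases
      case 1
      then have "\<forall>j. j \<notin> J \<longrightarrow> w j = 0"
        using w by auto
      then show ?thesis
        unfolding sum 1 using l by simp
    next
      case 2
      \<comment> \<open>Rescale so that the coefficient of \<open>e\<^sub>k\<close> becomes \<open>1\<close>.\<close>
    define u where "u j = (if j = k then 0 else inverse (w k) * w j)" for j
      have "a \<le> \<phi> (u(k := 1)) - ?L u"
        using w by (intro upper) (auto simp: u_def coord_space_def)
      also have "u(k := 1) = (\<lambda>j. inverse (w k) * w j)"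
        using 2 by (auto simp: u_def)
      also have "\<phi> \<dots> - ?L u \<le> inverse (w k) * \<phi> w - inverse (w k) * ?L w"
        unfolding u_def part using homog[of "inverse (w k)" w] 2 by simp
      finally show ?thesis
        unfolding sum using 2 by (simp add: field_simps)
    next
      case 3
      define u where "u j = (if j = k then 0 else inverse (- w k) * w j)" for j
      have "inverse (- w k) * ?L w - inverse (- w k) * \<phi> w \<le> ?L u - \<phi> (\<lambda>j. inverse (- w k) * w j)"
        unfolding u_def part using homog[of "inverse (- w k)" w] 3 by simp
      also have "(\<lambda>j. inverse (- w k) * w j) = u(k := -1)"
        using 3 by (auto simp: u_def coord_space_def)
      also have "?L u - \<phi> (u(k := -1)) \<le> a"
        using w by (intro lower) (auto simp: u_def coord_space_def)
      finally have "inverse (- w k) * (?L w - \<phi> w) \<le> a"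
        by (simp add: right_diff_distrib)
      then have "?L w - \<phi> w \<le> a * (- w k)"
        using 3 by (simp add: field_simps)
      then show ?thesis
        unfolding sum by simp
    qed
  qed
  then show ?case
    by blast
qed

definition coord_cone :: "nat set \<Rightarrow> (nat \<Rightarrow> real) set \<Rightarrow> bool" where
  "coord_cone J D \<longleftrightarrow> D \<subseteq> coord_space J \<and> (\<lambda>_. 0) \<in> D \<and>
     (\<forall>v\<in>D. \<forall>w\<in>D. (\<lambda>j. v j + w j) \<in> D) \<and> (\<forall>v\<in>D. \<forall>c>0. (\<lambda>j. c * v j) \<in> D)"

definition has_nonneg_functional :: "nat set \<Rightarrow> (nat \<Rightarrow> real) set \<Rightarrow> bool" where
  "has_nonneg_functional J D \<longleftrightarrow>
     (\<exists>l. (\<exists>j\<in>J. l j \<noteq> 0) \<and> (\<forall>v\<in>D. 0 \<le> (\<Sum>j\<in>J. l j * v j)))"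

text \<open>
  Forget the coordinate \<open>k\<close>. If the projected cone is still proper, a functional for it serves. Otherwise each
  vertical fibre of \<open>D\<close> is nonempty, and bounded on one side because \<open>\<plusminus> e\<^sub>k\<close> cannot both lie in the proper cone
  \<open>D\<close>. The endpoints of the fibres form a sublinear function \<open>\<phi>\<close>, and \<open>D\<close> lies above a linear minorant of it.
\<close>

lemma nonneg_functional_step:
  assumes J: "finite J" "k \<notin> J"
    and IH: "\<And>D. coord_cone J D \<Longrightarrow> D \<noteq> coord_space J \<Longrightarrow> has_nonneg_functional J D"
    and cone: "coord_cone (insert k J) D" and proper: "D \<noteq> coord_space (insert k J)"
  shows "has_nonneg_functional (insert k J) D"
proof -
  have supp: "v j = 0" if "v \<in> D" "j \<notin> insert k J" for v j
    using cone that by (auto simp: coord_cone_def coord_space_def)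
  have D0: "(\<lambda>_. 0) \<in> D"
    using cone by (simp add: coord_cone_def)
  have Dadd: "(\<lambda>j. v j + w j) \<in> D" if "v \<in> D" "w \<in> D" for v w
    using cone that by (simp add: coord_cone_def)
  have Dscale: "(\<lambda>j. c * v j) \<in> D" if "0 < c" "v \<in> D" for c v
    using cone that by (simp add: coord_cone_def)
  obtain v0 where v0: "v0 \<notin> D" "\<forall>j. j \<notin> insert k J \<longrightarrow> v0 j = 0"
    using cone proper by (auto simp: coord_cone_def coord_space_def)
  define D' where "D' = (\<lambda>v. v(k := 0)) ` D"
  show ?thesis
  proof (cases "\<exists>u. u \<notin> D' \<and> (\<forall>j. j \<notin> J \<longrightarrow> u j = 0)")
    case True
    then obtain u where u: "u \<notin> D'" "\<And>j. j \<notin> J \<Longrightarrow> u j = 0"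
      by blast
    have supp': "v j = 0" if v: "v \<in> D'" "j \<notin> J" for v j
    proof -
      obtain v1 where "v1 \<in> D" "v = v1(k := 0)"
        using v(1) by (auto simp: D'_def)
      then show ?thesis
        using supp[of v1 j] v(2) by simp
    qed
    have zero': "(\<lambda>_. 0) \<in> D'"
        unfolding D'_def using D0 by (intro image_eqI[of _ _ "\<lambda>_. 0"]) auto
    have add': "(\<lambda>j. v j + w j) \<in> D'" if vw: "v \<in> D'" "w \<in> D'" for v w
      proof -
        obtain v1 w1 where "v = v1(k := 0)" "w = w1(k := 0)" "v1 \<in> D" "w1 \<in> D"
          using vw by (auto simp: D'_def)
        then show ?thesis
          unfolding D'_def using Dadd[of v1 w1] by (intro image_eqI[of _ _ "\<lambda>j. v1 j + w1 j"]) auto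
      qed
    have scale': "(\<lambda>j. c * v j) \<in> D'" if cv: "0 < c" "v \<in> D'" for c v
      proof -
        obtain v1 where "v = v1(k := 0)" "v1 \<in> D"
          using cv by (auto simp: D'_def)
        then show ?thesis
          unfolding D'_def using Dscale[of c v1] cv by (intro image_eqI[of _ _ "\<lambda>j. c * v1 j"]) auto
      qed
    have "coord_cone J D'"
      unfolding coord_cone_def coord_space_def using supp' zero' add' scale' by blast
    moreover have "D' \<noteq> coord_space J"
      using u by (auto simp: coord_space_def)
    ultimately have "has_nonneg_functional J D'"
      by (rule IH)
    then obtain l where l: "\<exists>j\<in>J. l j \<noteq> 0" "\<And>v. v \<in> D \<Longrightarrow> 0 \<le> (\<Sum>j\<in>J. l j * (v(k := 0)) j)"
      unfolding D'_def has_nonneg_functional_def by blast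
    have "(\<Sum>j\<in>insert k J. (l(k := 0)) j * v j) = (\<Sum>j\<in>J. l j * (v(k := 0)) j)" for v
      using J by (simp, intro sum.cong) auto
    then have "\<forall>v\<in>D. 0 \<le> (\<Sum>j\<in>insert k J. (l(k := 0)) j * v j)"
      using l(2) by simp
    moreover have "\<exists>j\<in>insert k J. (l(k := 0)) j \<noteq> 0"
      using l(1) J by auto
    ultimately show ?thesis
      unfolding has_nonneg_functional_def by blast
  next
    case False
    then have full: "u \<in> D'" if "\<And>j. j \<notin> J \<Longrightarrow> u j = 0" for u
      using that by blast
    define e where "e s = (\<lambda>j. if j = k then s else 0 :: real)" for s
    have e_scale: "e (c * s) \<in> D" if "0 < c" "e s \<in> D" for c s
    proof -
      have "e (c * s) = (\<lambda>j. c * e s j)"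
        by (auto simp: e_def)
      then show ?thesis
        using Dscale that by simp
    qed
    have "\<not> (e 1 \<in> D \<and> e (-1) \<in> D)"
    proof
      assume e: "e 1 \<in> D \<and> e (-1) \<in> D"
      have all: "e s \<in> D" for s
        using e_scale[of s 1] e_scale[of "-s" "-1"] e D0 
        by (cases s "0 :: real" rule: linorder_cases) (simp_all add: e_def)
      have "v0(k := 0) \<in> D'"
        using v0(2) by (intro full) simp
      then obtain u where u: "u \<in> D" "v0(k := 0) = u(k := 0)"
        by (auto simp: D'_def)
      define r where "r = v0 k - u k"
      have "v0 = (\<lambda>j. u j + e r j)"
      proof
        fix j show "v0 j = u j + e r j"
          using fun_cong[OF u(2), of j] by (auto simp: e_def r_def split: if_splits)
      qed
      then show False
        using v0(1) Dadd[OF u(1) all, of r] by blast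
    qed
    then obtain \<sigma> :: real where \<sigma>: "\<sigma> * \<sigma> = 1" "e (- \<sigma>) \<notin> D"
      by (metis minus_minus mult_1 mult_minus1)
    \<comment> \<open>The sign \<open>\<sigma>\<close> is chosen so that the fibre over \<open>w\<close> is bounded from below.\<close>
    define S where "S w = {s. (\<lambda>j. if j = k then \<sigma> * s else if j \<in> J then w j else 0) \<in> D}" for w
    define \<phi> where "\<phi> w = Inf (S w)" for w
    have S_ne: "S w \<noteq> {}" for w
    proof -
      have "(\<lambda>j. if j \<in> J then w j else 0) \<in> D'"
        by (intro full) auto
      then obtain u where u: "u \<in> D" "(\<lambda>j. if j \<in> J then w j else 0) = u(k := 0)"
        by (auto simp: D'_def)
      have "u = (\<lambda>j. if j = k then \<sigma> * (\<sigma> * u k) else if j \<in> J then w j else 0)"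
      proof
        fix j show "u j = (if j = k then \<sigma> * (\<sigma> * u k) else if j \<in> J then w j else 0)"
          using fun_cong[OF u(2), of j] \<sigma>(1) by (auto simp: mult.assoc[symmetric] split: if_splits)
      qed
      then have "\<sigma> * u k \<in> S w"
        unfolding S_def using u(1) by simp
      then show ?thesis
        by blast
    qed
    have S_add: "s + r \<in> S (\<lambda>j. v j + w j)" if "s \<in> S v" "r \<in> S w" for s r v w
    proof -
      have "(\<lambda>j. if j = k then \<sigma> * (s + r) else if j \<in> J then v j + w j else 0) =
        (\<lambda>j. (if j = k then \<sigma> * s else if j \<in> J then v j else 0) + (if j = k then \<sigma> * r else if j \<in> J then w j else 0))"
        by (auto simp: distrib_left)
      then show ?thesis
        using Dadd that by (simp add: S_def)
    qed
    have S_scale: "c * s \<in> S (\<lambda>j. c * v j)" if "0 < c" "s \<in> S v" for c s v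
    proof -
      have "(\<lambda>j. if j = k then \<sigma> * (c * s) else if j \<in> J then c * v j else 0) =
        (\<lambda>j. c * (if j = k then \<sigma> * s else if j \<in> J then v j else 0))"
        by auto
      then show ?thesis
        using Dscale[OF that(1)] that(2) by (simp add: S_def)
    qed
    have S_zero: "0 \<le> s" if "s \<in> S (\<lambda>_. 0)" for s
    proof (rule ccontr)
      assume s: "\<not> 0 \<le> s"
      have "(\<lambda>j. if j = k then \<sigma> * s else if j \<in> J then 0 else 0) = e (\<sigma> * s)"
        by (auto simp: e_def)
      then have "e (\<sigma> * s) \<in> D"
        using that by (simp add: S_def)
      moreover have "inverse (- s) * (\<sigma> * s) = - \<sigma>"
        using s by (simp add: field_simps)
      ultimately show False
        using \<sigma>(2) s e_scale[of "inverse (- s)" "\<sigma> * s"] by (metis inverse_positive_iff_positive neg_0_less_iff_less not_le)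
    qed
    have S_bdd: "bdd_below (S w)" for w
    proof -
      obtain r where r: "r \<in> S (\<lambda>j. - w j)"
        using S_ne by blast
      have "- r \<le> s" if "s \<in> S w" for s
        using S_zero S_add[OF that r] by force
      then show ?thesis
        by (rule bdd_belowI)
    qed
    have \<phi>_le: "\<phi> w \<le> s" if "s \<in> S w" for s w
      unfolding \<phi>_def using that S_bdd by (rule cInf_lower)
    have le_\<phi>: "b \<le> \<phi> w" if "\<And>s. s \<in> S w \<Longrightarrow> b \<le> s" for b w
      unfolding \<phi>_def using S_ne that by (rule cInf_greatest)
    have "\<exists>l. \<forall>w. (\<forall>j. j \<notin> J \<longrightarrow> w j = 0) \<longrightarrow> (\<Sum>j\<in>J. l j * w j) \<le> \<phi> w"
    proof (rule finite_dim_hahn_banach[OF J(1)])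
      fix v w
      have "\<phi> (\<lambda>j. v j + w j) - \<phi> w \<le> s" if s: "s \<in> S v" for s
      proof -
        have "\<phi> (\<lambda>j. v j + w j) - s \<le> r" if "r \<in> S w" for r
          using \<phi>_le[OF S_add[OF s that]] by linarith
        then have "\<phi> (\<lambda>j. v j + w j) - s \<le> \<phi> w"
          by (rule le_\<phi>)
        then show ?thesis
          by linarith
      qed
      then have "\<phi> (\<lambda>j. v j + w j) - \<phi> w \<le> \<phi> v"
        by (rule le_\<phi>)
      then show "\<phi> (\<lambda>j. v j + w j) \<le> \<phi> v + \<phi> w"
        by linarith
    next
      fix c :: real and v assume c: "0 < c"
      have "inverse c * \<phi> (\<lambda>j. c * v j) \<le> s" if "s \<in> S v" for s
        using \<phi>_le[OF S_scale[OF c that]] c by (simp add: field_simps)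
      then have "inverse c * \<phi> (\<lambda>j. c * v j) \<le> \<phi> v"
        by (rule le_\<phi>)
      then show "\<phi> (\<lambda>j. c * v j) \<le> c * \<phi> v"
        using c by (simp add: field_simps)
    qed (rule le_\<phi>, rule S_zero)
    then obtain l where l: "\<And>w. (\<forall>j. j \<notin> J \<longrightarrow> w j = 0) \<Longrightarrow> (\<Sum>j\<in>J. l j * w j) \<le> \<phi> w"
      by blast
    define m where "m j = (if j = k then \<sigma> else - l j)" for j
    have "0 \<le> (\<Sum>j\<in>insert k J. m j * v j)" if v: "v \<in> D" for v
    proof -
      have "v = (\<lambda>j. if j = k then \<sigma> * (\<sigma> * v k) else if j \<in> J then (v(k := 0)) j else 0)"
        using supp[OF v] \<sigma>(1) by (auto simp: mult.assoc[symmetric])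
      then have "\<sigma> * v k \<in> S (v(k := 0))"
        unfolding S_def using v by simp
      then have "\<phi> (v(k := 0)) \<le> \<sigma> * v k"
        by (rule \<phi>_le)
      moreover have "(\<Sum>j\<in>J. l j * (v(k := 0)) j) \<le> \<phi> (v(k := 0))"
        using supp[OF v] by (intro l) auto
      moreover have "(\<Sum>j\<in>insert k J. m j * v j) = \<sigma> * v k - (\<Sum>j\<in>J. l j * (v(k := 0)) j)"
      proof -
        have "(\<Sum>j\<in>J. m j * v j) = (\<Sum>j\<in>J. - (l j * (v(k := 0)) j))"
          using J by (intro sum.cong) (auto simp: m_def)
        then show ?thesis
          using J by (simp add: m_def sum_negf)
      qed
      ultimately show ?thesis
        by linarith
    qed
    moreover have "m k \<noteq> 0"
      using \<sigma>(1) by (auto simp: m_def)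
    ultimately show ?thesis
      unfolding has_nonneg_functional_def by blast
  qed
qed

text \<open>
  Separation from a proper cone that may fail to be closed; only \<open>l \<noteq> 0\<close> excludes the trivial answer.
\<close>

lemma finite_dim_cone_functional:
  assumes "finite J" "coord_cone J D" "D \<noteq> coord_space J"
  shows "has_nonneg_functional J D"
  using assms
proof (induction J arbitrary: D rule: finite_induct)
  case empty
  have "coord_space {} = {\<lambda>_. 0}"
    by (auto simp: coord_space_def)
  then show ?case
    using empty by (auto simp: coord_cone_def)
next
  case (insert k J)
  show ?case
    by (rule nonneg_functional_step[OF insert.hyps insert.IH insert.prems])
qed

text \<open>
  Variables are numbered from \<open>1\<close>, so index \<open>0\<close> can carry the constant coefficient.
\<close>

definition affine_poly :: "nat set \<Rightarrow> (nat \<Rightarrow> real) \<Rightarrow> mpoly" where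
  "affine_poly I v = mconst (v 0) + (\<Sum>j\<in>I. mconst (v j) * mvar j)"

lemma meval_affine_poly: "meval x (affine_poly I v) = v 0 + (\<Sum>j\<in>I. v j * x j)"
  by (simp add: affine_poly_def)

lemma affine_poly_add: "affine_poly I (\<lambda>j. v j + w j) = affine_poly I v + affine_poly I w"
  by (simp add: affine_poly_def mconst_add distrib_right sum.distrib add_ac)

lemma affine_poly_smult: "affine_poly I (\<lambda>j. c * v j) = mconst c * affine_poly I v"
  by (simp add: affine_poly_def mconst_mult distrib_left sum_distrib_left mult.assoc)

text \<open>
  If \<open>p \<notin> C\<close>, some nonzero functional \<open>l\<close> on affine functions is nonnegative on \<open>C\<close> and nonpositive at
  \<open>p\<close>. When \<open>l(1) > 0\<close>, it is a multiple of the evaluation at a point of \<open>K\<close>, where \<open>p\<close> would not be positive. When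
  \<open>l(1) = 0\<close>, it is a direction in which \<open>K\<close> is unbounded.
\<close>

lemma affine_farkas:
  assumes I: "finite I" "0 \<notin> I"
    and const: "\<And>c. 0 \<le> c \<Longrightarrow> mconst c \<in> C"
    and add: "\<And>a b. a \<in> C \<Longrightarrow> b \<in> C \<Longrightarrow> a + b \<in> C"
    and scale: "\<And>c a. 0 \<le> c \<Longrightarrow> a \<in> C \<Longrightarrow> mconst c * a \<in> C"
    and K: "K = {x. \<forall>v. affine_poly I v \<in> C \<longrightarrow> 0 \<le> meval x (affine_poly I v)}"
    and ne: "K \<noteq> {}"
    and bdd: "\<And>x j. x \<in> K \<Longrightarrow> j \<in> I \<Longrightarrow> \<bar>x j\<bar> \<le> B"
    and pos: "\<And>x. x \<in> K \<Longrightarrow> 0 < meval x (affine_poly I p)"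
  shows "affine_poly I p \<in> C"
proof (rule ccontr)
  assume notin: "affine_poly I p \<notin> C"
  let ?J = "insert 0 I"
  let ?A = "affine_poly I"
  \<comment> \<open>The coefficient vectors in the cone spanned by \<open>C\<close> and \<open>- p\<close>; it is proper since it omits \<open>p\<close>.\<close>
  define D where "D = {v. (\<forall>j. j \<notin> ?J \<longrightarrow> v j = 0) \<and> (\<exists>s\<ge>0. ?A v + mconst s * ?A p \<in> C)}"
  define p' where "p' j = (if j \<in> ?J then p j else 0)" for j
  have trunc: "?A (\<lambda>j. if j \<in> ?J then v j else 0) = ?A v" for v
    by (simp add: affine_poly_def)
  have p': "?A p' = ?A p"
    unfolding p'_def[abs_def] by (rule trunc)
  have "coord_cone ?J D"
    unfolding coord_cone_def
  proof (intro conjI)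
    show "D \<subseteq> coord_space ?J"
      by (auto simp: D_def coord_space_def)
    show "(\<lambda>_. 0) \<in> D"
      using const[of 0] by (auto simp: D_def affine_poly_def intro!: exI[of _ 0])
    show "\<forall>v\<in>D. \<forall>w\<in>D. (\<lambda>j. v j + w j) \<in> D"
    proof (intro ballI)
      fix v w assume vw: "v \<in> D" "w \<in> D"
      obtain s r where "0 \<le> s" "0 \<le> r" "?A v + mconst s * ?A p \<in> C" "?A w + mconst r * ?A p \<in> C"
        using vw by (auto simp: D_def)
      then have "0 \<le> s + r" "?A (\<lambda>j. v j + w j) + mconst (s + r) * ?A p \<in> C"
        using add[of "?A v + mconst s * ?A p" "?A w + mconst r * ?A p"]
        by (simp_all add: affine_poly_add mconst_add algebra_simps)
      then show "(\<lambda>j. v j + w j) \<in> D"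
        using vw unfolding D_def by auto
    qed
    show "\<forall>v\<in>D. \<forall>c>0. (\<lambda>j. c * v j) \<in> D"
    proof (intro ballI allI impI)
      fix v and c :: real assume cv: "0 < c" "v \<in> D"
      obtain s where "0 \<le> s" "?A v + mconst s * ?A p \<in> C"
        using cv(2) by (auto simp: D_def)
      then have "0 \<le> c * s" "?A (\<lambda>j. c * v j) + mconst (c * s) * ?A p \<in> C"
        using scale[of c "?A v + mconst s * ?A p"] cv(1)
        by (simp_all add: affine_poly_smult mconst_mult algebra_simps)
      then show "(\<lambda>j. c * v j) \<in> D"
        using cv unfolding D_def by auto
    qed
  qed
  moreover have "p' \<notin> D"
  proof
    assume "p' \<in> D"
    then obtain s where s: "0 \<le> s" "?A p + mconst s * ?A p \<in> C"
      by (auto simp: D_def p')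
    have "mconst (inverse (1 + s)) * (?A p + mconst s * ?A p) = mconst (inverse (1 + s) * (1 + s)) * ?A p"
      by (simp only: mconst_mult mconst_add mconst_1) (simp add: algebra_simps)
    also have "\<dots> = ?A p"
      using s by simp
    finally show False
      using scale[OF _ s(2), of "inverse (1 + s)"] s(1) notin by simp
  qed
  then have "D \<noteq> coord_space ?J"
    by (auto simp: p'_def coord_space_def)
  ultimately have "has_nonneg_functional ?J D"
    using I(1) by (intro finite_dim_cone_functional) simp
  then obtain l where l: "\<exists>j\<in>?J. l j \<noteq> 0" and "\<forall>v\<in>D. 0 \<le> (\<Sum>j\<in>?J. l j * v j)"
    unfolding has_nonneg_functional_def by blast
  then have lD: "0 \<le> l 0 * v 0 + (\<Sum>j\<in>I. l j * v j)" if "v \<in> D" for v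
    using that I by auto
  have lC: "0 \<le> l 0 * v 0 + (\<Sum>j\<in>I. l j * v j)" if "?A v \<in> C" for v
  proof -
    have "(\<lambda>j. if j \<in> ?J then v j else 0) \<in> D"
      unfolding D_def using that trunc[of v] by (auto intro!: exI[of _ 0])
    from lD[OF this] show ?thesis
      by simp
  qed
  have lp: "l 0 * p 0 + (\<Sum>j\<in>I. l j * p j) \<le> 0"
  proof -
    have "?A (\<lambda>j. - p' j) = mconst (-1) * ?A p"
      using affine_poly_smult[of I "-1" p'] p' by simp
    then have "?A (\<lambda>j. - p' j) + mconst 1 * ?A p \<in> C"
      using const[of 0] by (simp add: mconst_uminus)
    then have "(\<lambda>j. - p' j) \<in> D"
      unfolding D_def by (auto simp: p'_def intro!: exI[of _ 1])
    from lD[OF this] show ?thesis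
      by (simp add: p'_def sum_negf)
  qed
  have l0: "0 \<le> l 0"
  proof -
    let ?u = "\<lambda>j. if j = 0 then 1 else 0 :: real"
    have "(\<Sum>j\<in>I. mconst (?u j) * mvar j) = 0" "(\<Sum>j\<in>I. l j * ?u j) = 0"
      using I(2) by (auto intro!: sum.neutral)
    then show ?thesis
      using lC[of ?u] const[of 1] by (simp add: affine_poly_def)
  qed
  obtain x0 where x0: "x0 \<in> K"
    using ne by blast
  show False
  proof (cases "l 0 = 0")
    case True
    then obtain j where j: "j \<in> I" "l j \<noteq> 0"
      using l by auto
    define s where "s = (\<bar>B\<bar> + \<bar>x0 j\<bar> + 1) / \<bar>l j\<bar>"
    have s: "0 \<le> s" "s * \<bar>l j\<bar> = \<bar>B\<bar> + \<bar>x0 j\<bar> + 1"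
      using j by (simp_all add: s_def)
    have "(\<lambda>i. x0 i + s * l i) \<in> K"
      unfolding K
    proof (intro CollectI allI impI)
      fix v assume v: "?A v \<in> C"
      have "meval (\<lambda>i. x0 i + s * l i) (?A v) = meval x0 (?A v) + s * (\<Sum>j\<in>I. l j * v j)"
        by (simp add: meval_affine_poly distrib_left sum.distrib sum_distrib_left mult_ac)
      moreover have "0 \<le> meval x0 (?A v)"
        using x0 v by (simp add: K)
      moreover have "0 \<le> s * (\<Sum>j\<in>I. l j * v j)"
        using lC[OF v] True s by simp
      ultimately show "0 \<le> meval (\<lambda>i. x0 i + s * l i) (?A v)"
        by linarith
    qed
    then have "\<bar>x0 j + s * l j\<bar> \<le> B"
      using bdd j by blast
    moreover have "\<bar>s * l j\<bar> = \<bar>B\<bar> + \<bar>x0 j\<bar> + 1"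
      using s by (simp add: abs_mult)
    ultimately show False
      by linarith
  next
    case False
    define y where "y j = l j / l 0" for j
    have y: "l 0 * meval y (?A v) = l 0 * v 0 + (\<Sum>j\<in>I. l j * v j)" for v
      using False by (simp add: meval_affine_poly y_def distrib_left sum_distrib_left mult.commute)
    have "0 \<le> meval y (?A v)" if "?A v \<in> C" for v
      using lC[OF that] False l0 unfolding y[symmetric] by (simp add: zero_le_mult_iff)
    then have "0 < meval y (?A p)"
      by (intro pos) (simp add: K)
    then have "0 < l 0 * meval y (?A p)"
      using False l0 by simp
    then show False
      using lp unfolding y by linarith
  qed
qed

section \<open>Affine matrices\<close>

lemma affine_poly_single:
  "affine_poly I v = Poly_Mapping.single 0 (v 0) + (\<Sum>j\<in>I. Poly_Mapping.single (Poly_Mapping.single j 1) (v j))"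
  by (simp add: affine_poly_def mconst_def mvar_def mult_single)

lemma total_degree_le_1_affine:
  assumes p: "p \<in> mpoly_ring I" "total_degree p \<le> 1" and I: "finite I" "0 \<notin> I"
  shows "p \<in> range (affine_poly I)"
proof -
  define v where "v j = (if j = 0 then Poly_Mapping.lookup p 0 else Poly_Mapping.lookup p (Poly_Mapping.single j 1))" for j
  let ?s = "\<lambda>j :: nat. Poly_Mapping.single j (1 :: nat)"
  let ?S = "insert 0 (?s ` I)"
  have keys: "Poly_Mapping.keys p \<subseteq> ?S"
  proof
    fix m assume m: "m \<in> Poly_Mapping.keys p"
    have mI: "Poly_Mapping.keys m \<subseteq> I"
      using p(1) m by (auto simp: mpoly_ring_def mvars_def)
    have "(\<Sum>j\<in>Poly_Mapping.keys m. Poly_Mapping.lookup m j) \<le> total_degree p"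
      unfolding total_degree_def using m by (intro Max_ge) auto
    then have deg: "(\<Sum>j\<in>Poly_Mapping.keys m. Poly_Mapping.lookup m j) \<le> 1"
      using p(2) by linarith
    show "m \<in> ?S"
    proof (cases "m = 0")
      case False
      then obtain j where j: "j \<in> Poly_Mapping.keys m"
        by (metis ex_in_conv keys_eq_empty)
      have split: "Poly_Mapping.lookup m j + (\<Sum>i\<in>Poly_Mapping.keys m - {j}. Poly_Mapping.lookup m i) \<le> 1"
        using deg j by (simp add: sum.remove)
      have j1: "Poly_Mapping.lookup m j \<ge> 1"
        using j by (simp add: in_keys_iff)
      have others: "Poly_Mapping.lookup m i = 0" if "i \<noteq> j" for i
      proof (rule ccontr)
        assume "Poly_Mapping.lookup m i \<noteq> 0"
        then have "i \<in> Poly_Mapping.keys m - {j}"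
          using that by (simp add: in_keys_iff)
        then have "Poly_Mapping.lookup m i \<le> (\<Sum>i\<in>Poly_Mapping.keys m - {j}. Poly_Mapping.lookup m i)"
          by (intro member_le_sum) auto
        then show False
          using split j1 \<open>Poly_Mapping.lookup m i \<noteq> 0\<close> by linarith
      qed
      have "m = ?s j"
      proof (rule poly_mapping_eqI)
        fix i
        show "Poly_Mapping.lookup m i = Poly_Mapping.lookup (?s j) i"
          using others[of i] split j1 by (cases "i = j") (auto simp: lookup_single)
      qed
      then show ?thesis
        using j mI by blast
    qed simp
  qed
  have "p = (\<Sum>m\<in>?S. Poly_Mapping.single m (Poly_Mapping.lookup p m))"
  proof -
    have "(\<Sum>m\<in>Poly_Mapping.keys p. Poly_Mapping.single m (Poly_Mapping.lookup p m)) =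
       (\<Sum>m\<in>?S. Poly_Mapping.single m (Poly_Mapping.lookup p m))"
      using keys I by (intro sum.mono_neutral_left) (auto simp: in_keys_iff)
    then show ?thesis
      using mpoly_as_sum[of p] by simp
  qed
  also have "\<dots> = Poly_Mapping.single 0 (Poly_Mapping.lookup p 0) +
      (\<Sum>m\<in>?s ` I. Poly_Mapping.single m (Poly_Mapping.lookup p m))"
  proof (rule sum.insert)
    show "0 \<notin> ?s ` I"
    proof
      assume "0 \<in> ?s ` I"
      then obtain j where "0 = ?s j"
        by blast
      then have "Poly_Mapping.lookup (?s j) j = 0"
        by (metis lookup_zero)
      then show False
        by simp
    qed
  qed (use I in simp)
  also have "(\<Sum>m\<in>?s ` I. Poly_Mapping.single m (Poly_Mapping.lookup p m)) =
      (\<Sum>j\<in>I. Poly_Mapping.single (?s j) (Poly_Mapping.lookup p (?s j)))"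
  proof (subst sum.reindex)
    show "inj_on ?s I"
    proof (rule inj_onI)
      fix i j assume "?s i = ?s j"
      then have "Poly_Mapping.lookup (?s j) i = 1"
        by (metis lookup_single_eq)
      then show "i = j"
        by (auto simp: lookup_single when_def split: if_splits)
    qed
  qed simp
  also have "\<dots> = (\<Sum>j\<in>I. Poly_Mapping.single (?s j) (v j))"
    using I(2) by (intro sum.cong refl) (auto simp: v_def)
  finally have "p = affine_poly I v"
    by (simp add: affine_poly_single v_def)
  then show ?thesis
    by simp
qed

lemma range_affine_add: "a \<in> range (affine_poly I) \<Longrightarrow> b \<in> range (affine_poly I) \<Longrightarrow> a + b \<in> range (affine_poly I)"
  by (auto simp flip: affine_poly_add)

lemma range_affine_smult: "a \<in> range (affine_poly I) \<Longrightarrow> mconst c * a \<in> range (affine_poly I)"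
  by (auto simp flip: affine_poly_smult)

lemma range_affine_sum:
  "(\<And>a. a \<in> A \<Longrightarrow> f a \<in> range (affine_poly I)) \<Longrightarrow> sum f A \<in> range (affine_poly I)"
proof (induction A rule: infinite_finite_induct)
  case (insert a A)
  then show ?case
    by (simp add: range_affine_add)
qed (auto intro!: range_eqI[of _ _ "\<lambda>_. 0"] simp: affine_poly_def)

lemma affine_poly_coord:
  assumes "finite I" "0 \<notin> I" "j \<in> I"
  shows "affine_poly I (\<lambda>i. if i = 0 then N else if i = j then s else 0) = mconst N + mconst s * mvar j"
proof -
  have "(\<Sum>i\<in>I. mconst (if i = 0 then N else if i = j then s else 0) * mvar i) =
     (\<Sum>i\<in>I. if i = j then mconst s * mvar i else 0)"
    using assms(2) by (intro sum.cong refl) auto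
  then show ?thesis
    using assms by (simp add: affine_poly_def)
qed

text \<open>
  The Farkas lemma is applied to the cone generated by \<open>1\<close> and the forms \<open>v\<^sup>T U v\<close> only, not to all multipliers:
  nonnegativity of these generators at \<open>x0\<close> is evident from \<open>U(x0) \<succeq> 0\<close>.
\<close>

lemma bounded_of_compact_spectrahedron:
  assumes U: "U \<in> carrier_mat d d" "sym_mat U" "elements_mat U \<subseteq> mpoly_ring I"
    and affine: "\<And>p. p \<in> elements_mat U \<Longrightarrow> total_degree p \<le> 1"
    and I: "finite I" "0 \<notin> I"
    and ne: "psd (eval_mat x0 U)"
    and bdd: "\<And>x j. psd (eval_mat x U) \<Longrightarrow> j \<in> I \<Longrightarrow> \<bar>x j\<bar> \<le> B"
    and j: "j \<in> I"
  shows "mvar j \<in> poly_semiring.bounded_elems (multipliers I U)"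
proof -
  interpret poly_semiring "multipliers I U" I
    using U(1) by (rule poly_semiring_multipliers)
  let ?q = "\<lambda>vs. sum_list (map (\<lambda>v. qform v U) vs)"
  define C where "C = {mconst c + ?q vs | c vs. 0 \<le> c}"
  define K where "K = {x. \<forall>v. affine_poly I v \<in> C \<longrightarrow> 0 \<le> meval x (affine_poly I v)}"
  have C_sub: "C \<subseteq> multipliers I U"
  proof -
    have "?q vs \<in> multipliers I U" for vs
      by (induction vs) (auto intro: add zero qform_multiplier[OF U(1,3)])
    then show ?thesis
      by (auto simp: C_def intro: add const)
  qed
  have C_const: "mconst c \<in> C" if "0 \<le> c" for c
    unfolding C_def using that by (intro CollectI exI[of _ c] exI[of _ "[]"]) simp
  have C_qform: "qform v U \<in> C" for v
    unfolding C_def by (intro CollectI exI[of _ 0] exI[of _ "[v]"]) simp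
  have C_add: "a + b \<in> C" if "a \<in> C" "b \<in> C" for a b
  proof -
    obtain c vs c' vs' where "0 \<le> c" "0 \<le> c'" "a = mconst c + ?q vs" "b = mconst c' + ?q vs'"
      using \<open>a \<in> C\<close> \<open>b \<in> C\<close> by (auto simp: C_def)
    then show ?thesis
      unfolding C_def
      by (intro CollectI exI[of _ "c + c'"] exI[of _ "vs @ vs'"]) (simp add: mconst_add algebra_simps)
  qed
  have C_scale: "mconst s * a \<in> C" if "0 \<le> s" "a \<in> C" for s a
  proof -
    obtain c vs where a: "0 \<le> c" "a = mconst c + ?q vs"
      using \<open>a \<in> C\<close> by (auto simp: C_def)
    have "mconst s * qform v U = qform (\<lambda>i. sqrt s * v i) U" for v
    proof -
      have sqrt: "(sqrt s * v i) * (sqrt s * v j) = (sqrt s * sqrt s) * (v i * v j)" for i j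
        by (simp only: mult_ac)
      have "mconst s * mconst (v i * v j) = mconst ((sqrt s * v i) * (sqrt s * v j))" for i j
        unfolding sqrt using \<open>0 \<le> s\<close> by (simp flip: mconst_mult)
      then show ?thesis
        by (simp add: qform_def sum_distrib_left flip: mult.assoc)
    qed
    then have "mconst s * ?q vs = ?q (map (\<lambda>v i. sqrt s * v i) vs)" for vs
      by (induction vs) (simp_all add: distrib_left)
    then show ?thesis
      unfolding C_def a(2) using a(1) \<open>0 \<le> s\<close>
      by (intro CollectI exI[of _ "s * c"] exI[of _ "map (\<lambda>v i. sqrt s * v i) vs"])
        (simp add: mconst_mult distrib_left)
  qed
  have K_psd: "psd (eval_mat x U)" if x: "x \<in> K" for x
    unfolding psd_eval_iff[OF U(1,2)]
  proof
    fix v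
    have "qform v U \<in> range (affine_poly I)"
      unfolding qform_def
    proof (intro range_affine_sum range_affine_smult)
      fix i j assume "i \<in> {..<dim_row U}" "j \<in> {..<dim_row U}"
      then have "U $$ (i, j) \<in> elements_mat U"
        using U(1) by auto
      then show "U $$ (i, j) \<in> range (affine_poly I)"
        using U(3) affine I by (intro total_degree_le_1_affine) auto
    qed
    then show "0 \<le> meval x (qform v U)"
      using x C_qform[of v] by (auto simp: K_def)
  qed
  have "x0 \<in> K"
  proof -
    have "0 \<le> meval x0 (?q vs)" for vs
      using ne by (induction vs) (auto simp: psd_eval_iff[OF U(1,2)])
    then have "0 \<le> meval x0 a" if "a \<in> C" for a
      using that by (auto simp: C_def)
    then show ?thesis
      by (simp add: K_def)
  qed
  then have K_ne: "K \<noteq> {}"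
    by blast
  have K_bdd: "\<bar>x j\<bar> \<le> B" if "x \<in> K" "j \<in> I" for x j
    using bdd K_psd that by blast
  have mem: "mconst (\<bar>B\<bar> + 1) + mconst s * mvar j \<in> C" if s: "\<bar>s\<bar> = 1" for s
  proof -
    have "affine_poly I (\<lambda>i. if i = 0 then \<bar>B\<bar> + 1 else if i = j then s else 0) \<in> C"
    proof (rule affine_farkas[OF I C_const C_add C_scale K_def K_ne])
      show "\<bar>x k\<bar> \<le> B" if "x \<in> K" "k \<in> I" for x k
        using K_bdd that .
    next
      fix x assume "x \<in> K"
      then have "\<bar>s * x j\<bar> \<le> B"
        using K_bdd[of x j] j s by (simp add: abs_mult)
      then show "0 < meval x (affine_poly I (\<lambda>i. if i = 0 then \<bar>B\<bar> + 1 else if i = j then s else 0))"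
        unfolding affine_poly_coord[OF I j] by simp
    qed
    then show ?thesis
      unfolding affine_poly_coord[OF I j] .
  qed
  show ?thesis
    using mem[of 1] mem[of "-1"] C_sub
    by (intro bounded_elemsI[of "\<bar>B\<bar> + 1"]) (auto simp: mconst_uminus)
qed

section \<open>Distributing positivity along the running intersection property\<close>

definition restrict0 :: "nat set \<Rightarrow> (nat \<Rightarrow> real) \<Rightarrow> nat \<Rightarrow> real" where
  "restrict0 J x = (\<lambda>j. if j \<in> J then x j else 0)"

lemma continuous_coord: "continuous_on A (\<lambda>x :: nat \<Rightarrow> real. x j)"
  by (rule continuous_on_subset[OF continuous_on_product_coordinates subset_UNIV])

lemma continuous_restrict0: "continuous_on A (restrict0 J)"
  unfolding restrict0_def
proof (rule continuous_on_coordinatewise_then_product)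
  show "continuous_on A (\<lambda>x. if j \<in> J then x j else 0)" for j
    by (cases "j \<in> J") (simp_all add: continuous_coord)
qed

lemma meval_restrict0: "p \<in> mpoly_ring J \<Longrightarrow> meval (restrict0 J x) p = meval x p"
  by (rule meval_cong) (auto simp: restrict0_def)

text \<open>
  Restriction to \<open>J\<close> with zeros elsewhere is needed for Stone-Weierstrass: polynomials in \<open>J\<close> separate points
  only after the other coordinates have been made constant.
\<close>

lemma mpoly_approximation:
  assumes "compact S" "continuous_on (restrict0 J ` S) g" "0 < e"
  obtains h where "h \<in> mpoly_ring J" "\<And>x. x \<in> S \<Longrightarrow> \<bar>g (restrict0 J x) - meval x h\<bar> < e"
proof -
  let ?R = "(\<lambda>p x. meval x p) ` mpoly_ring J"
  interpret function_ring_on ?R "restrict0 J ` S"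
  proof
    show "compact (restrict0 J ` S)"
      using assms(1) by (intro compact_continuous_image continuous_restrict0)
    show "continuous_on (restrict0 J ` S) f" if "f \<in> ?R" for f
      using that by (auto intro: continuous_meval)
    show "(\<lambda>x. f x + g x) \<in> ?R" if fg: "f \<in> ?R" "g \<in> ?R" for f g
    proof -
      obtain p q where "p \<in> mpoly_ring J" "q \<in> mpoly_ring J" "f = (\<lambda>x. meval x p)" "g = (\<lambda>x. meval x q)"
        using fg by blast
      then show ?thesis
        by (intro image_eqI[of _ _ "p + q"]) (auto intro: mpoly_ring_add)
    qed
    show "(\<lambda>x. f x * g x) \<in> ?R" if fg: "f \<in> ?R" "g \<in> ?R" for f g
    proof -
      obtain p q where "p \<in> mpoly_ring J" "q \<in> mpoly_ring J" "f = (\<lambda>x. meval x p)" "g = (\<lambda>x. meval x q)"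
        using fg by blast
      then show ?thesis
        by (intro image_eqI[of _ _ "p * q"]) (auto intro: mpoly_ring_mult)
    qed
    show "(\<lambda>_. c) \<in> ?R" for c
      by (intro image_eqI[of _ _ "mconst c"]) auto
    show "\<exists>f\<in>?R. f x \<noteq> f y" if xy: "x \<in> restrict0 J ` S" "y \<in> restrict0 J ` S" "x \<noteq> y" for x y
    proof -
      obtain j where j: "x j \<noteq> y j"
        using xy(3) by blast
      then have "j \<in> J"
        using xy(1,2) by (auto simp: restrict0_def split: if_splits)
      then show ?thesis
        using j by (intro bexI[OF _ imageI[OF mpoly_ring_mvar]]) simp_all
    qed
  qed
  obtain f where f: "f \<in> ?R" "\<forall>x\<in>restrict0 J ` S. \<bar>g x - f x\<bar> < e"
    using Stone_Weierstrass_basic[OF assms(2,3)] by blast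
  then obtain h where h: "h \<in> mpoly_ring J" "f = (\<lambda>x. meval x h)"
    by blast
  show ?thesis
  proof (rule that[OF h(1)])
    show "\<bar>g (restrict0 J x) - meval x h\<bar> < e" if "x \<in> S" for x
      using f(2) that by (auto simp: h(2) meval_restrict0[OF h(1)])
  qed
qed

text \<open>
  The penalty \<open>M d\<close>, with \<open>d\<close> the \<open>l\<^sup>1\<close> distance on the coordinates \<open>J\<close>, extends the inequality to all pairs; the
  supremum \<open>g\<close> is then a Lipschitz function between \<open>- p\<close> on \<open>A\<close> and \<open>q - e\<close> on \<open>B\<close>.
\<close>

lemma separating_polynomial:
  assumes A: "compact A" and B: "compact B" and J: "finite J"
    and pos: "\<And>x z. x \<in> A \<Longrightarrow> z \<in> B \<Longrightarrow> (\<And>j. j \<in> J \<Longrightarrow> x j = z j) \<Longrightarrow> 0 < meval x p + meval z q"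
  obtains h where "h \<in> mpoly_ring J"
    "\<And>x. x \<in> A \<Longrightarrow> 0 < meval x (p + h)" "\<And>z. z \<in> B \<Longrightarrow> 0 < meval z (q - h)"
proof (cases "A = {}")
  case True
  obtain b where "\<And>z. z \<in> B \<Longrightarrow> - b \<le> meval z q"
    using continuous_bounded_below[OF B continuous_meval] by blast
  then show ?thesis
    using True by (intro that[of "mconst (- b - 1)"]) (auto, fastforce)
next
  case False
  define d where "d x z = (\<Sum>j\<in>J. \<bar>x j - z j\<bar>)" for x z :: "nat \<Rightarrow> real"
  have d_nonneg: "0 \<le> d x z" for x z
    by (simp add: d_def sum_nonneg)
  have d_0: "x j = z j" if "d x z = 0" "j \<in> J" for x z j
    using that J by (simp add: d_def sum_nonneg_eq_0_iff)
  have d_cont: "continuous_on S (\<lambda>xz. d (fst xz) (snd xz))" for S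
    unfolding d_def
    by (intro continuous_intros continuous_on_compose2[OF continuous_coord[of UNIV]] subset_UNIV)
  define s where "s xz = meval (fst xz) p + meval (snd xz) q" for xz
  have s_cont: "continuous_on S s" for S
    unfolding s_def
    by (intro continuous_intros continuous_on_compose2[OF continuous_meval[of UNIV]] subset_UNIV)
  have AB: "compact (A \<times> B)"
    using A B by (rule compact_Times)
  obtain b where b: "0 \<le> b" "\<And>xz. xz \<in> A \<times> B \<Longrightarrow> - b \<le> s xz"
    using continuous_bounded_below[OF AB s_cont] by blast
  have closed_neg: "closed {xz. s xz \<le> 0}"
    by (intro closed_Collect_le s_cont continuous_intros)
  have "compact ((A \<times> B) \<inter> {xz. s xz \<le> 0})"
    using AB closed_neg by (rule compact_Int_closed)
  moreover have "0 < d (fst xz) (snd xz)" if "xz \<in> (A \<times> B) \<inter> {xz. s xz \<le> 0}" for xz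
  proof (rule ccontr)
    assume "\<not> 0 < d (fst xz) (snd xz)"
    then have d0: "d (fst xz) (snd xz) = 0"
      using d_nonneg[of "fst xz" "snd xz"] by linarith
    have "fst xz \<in> A" "snd xz \<in> B"
      using that by auto
    from pos[OF this d_0[OF d0]] have "0 < s xz"
      by (simp add: s_def)
    then show False
      using that by simp
  qed
  ultimately obtain \<delta> where \<delta>: "0 < \<delta>" "\<And>xz. xz \<in> (A \<times> B) \<inter> {xz. s xz \<le> 0} \<Longrightarrow> \<delta> \<le> d (fst xz) (snd xz)"
    using continuous_pos_bounded_below[OF _ d_cont] by blast
  \<comment> \<open>Where \<open>s \<le> 0\<close> the penalty is at least \<open>b + 1\<close>, which outweighs \<open>s \<ge> - b\<close>.\<close>
  define M where "M = (b + 1) / \<delta>"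
  have M: "0 < M" "M * \<delta> = b + 1"
    using \<delta>(1) b(1) by (simp_all add: M_def)
  have penal: "0 < s xz + M * d (fst xz) (snd xz)" if xz: "xz \<in> A \<times> B" for xz
  proof (cases "s xz \<le> 0")
    case True
    then have "M * \<delta> \<le> M * d (fst xz) (snd xz)"
      using \<delta>(2) M xz by (intro mult_left_mono) auto
    then show ?thesis
      using b(2)[OF xz] M by linarith
  next
    case False
    then show ?thesis
      using M d_nonneg[of "fst xz" "snd xz"] by (simp add: add_pos_nonneg)
  qed
  have "continuous_on (A \<times> B) (\<lambda>xz. s xz + M * d (fst xz) (snd xz))"
    by (intro continuous_intros s_cont d_cont)
  from continuous_pos_bounded_below[OF AB this penal] obtain e
    where e: "0 < e" "\<And>xz. xz \<in> A \<times> B \<Longrightarrow> e \<le> s xz + M * d (fst xz) (snd xz)"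
    by blast
  define g where "g y = (SUP x\<in>A. - meval x p - M * d x y)" for y
  obtain b' where b': "\<And>x. x \<in> A \<Longrightarrow> - b' \<le> meval x p"
    using continuous_bounded_below[OF A continuous_meval] by blast
  have bdd: "bdd_above ((\<lambda>x. - meval x p - M * d x y) ` A)" for y
  proof (rule bdd_aboveI2)
    fix x assume "x \<in> A"
    then show "- meval x p - M * d x y \<le> b'"
      using b'[of x] M d_nonneg[of x y] by (smt (verit) mult_nonneg_nonneg)
  qed
  have le_g: "- meval x p - M * d x y \<le> g y" if "x \<in> A" for x y
    unfolding g_def using that bdd by (rule cSUP_upper)
  have g_le: "g y \<le> c" if "\<And>x. x \<in> A \<Longrightarrow> - meval x p - M * d x y \<le> c" for y c
    unfolding g_def using False that by (rule cSUP_least)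
  have d_tri: "d x y \<le> d x y' + d y' y" for x y y'
    unfolding d_def sum.distrib[symmetric] by (intro sum_mono) linarith
  have g_lip: "g y' - g y \<le> M * d y' y" for y y'
  proof -
    have "- meval x p - M * d x y' \<le> g y + M * d y' y" if "x \<in> A" for x
    proof -
      have "M * d x y \<le> M * d x y' + M * d y' y"
        using mult_left_mono[OF d_tri[of x y y'], of M] M(1) by (simp add: distrib_left)
      then show ?thesis
        using le_g[OF that, of y] by linarith
    qed
    then have "g y' \<le> g y + M * d y' y"
      by (rule g_le)
    then show ?thesis
      by linarith
  qed
  have d_sym: "d x y = d y x" for x y
    by (simp add: d_def abs_minus_commute)
  have g_cont: "continuous_on S g" for S
    unfolding continuous_on_def
  proof
    fix y assume "y \<in> S"
    have "continuous_on S (\<lambda>y'. M * d y' y)"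
      unfolding d_def by (intro continuous_intros continuous_coord)
    then have "((\<lambda>y'. M * d y' y) \<longlongrightarrow> M * d y y) (at y within S)"
      using \<open>y \<in> S\<close> by (simp add: continuous_on_def)
    moreover have "d y y = 0"
      by (simp add: d_def)
    ultimately have lim: "((\<lambda>y'. M * d y' y) \<longlongrightarrow> 0) (at y within S)"
      by simp
    have "norm (g y' - g y) \<le> M * d y' y" for y'
      using g_lip[of y' y] g_lip[of y y'] by (simp add: d_sym abs_le_iff)
    then have "\<forall>\<^sub>F y' in at y within S. norm (g y' - g y) \<le> M * d y' y"
      by (intro always_eventually allI)
    then have "((\<lambda>y'. g y' - g y) \<longlongrightarrow> 0) (at y within S)"
      using lim by (rule Lim_null_comparison)
    then show "(g \<longlongrightarrow> g y) (at y within S)"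
      by (simp add: LIM_zero_iff)
  qed
  have g_restrict: "g (restrict0 J y) = g y" for y
  proof -
    have "d x (restrict0 J y) = d x y" for x
      unfolding d_def by (intro sum.cong) (auto simp: restrict0_def)
    then show ?thesis
      by (simp add: g_def)
  qed
  have AB': "compact (A \<union> B)"
    using A B by (rule compact_Un)
  have cont: "continuous_on (restrict0 J ` (A \<union> B)) (\<lambda>y. g y + e / 2)"
    by (intro continuous_on_add g_cont continuous_on_const)
  have half: "0 < e / 2"
    using e(1) by simp
  from mpoly_approximation[OF AB' cont half] obtain h where h: "h \<in> mpoly_ring J"
    "\<And>x. x \<in> A \<union> B \<Longrightarrow> \<bar>(g (restrict0 J x) + e / 2) - meval x h\<bar> < e / 2"
    by blast
  show ?thesis
  proof (rule that[OF h(1)])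
    fix x assume x: "x \<in> A"
    have "d x x = 0"
      by (simp add: d_def)
    then have "- meval x p \<le> g x"
      using le_g[OF x, of x] by simp
    moreover have "\<bar>g x + e / 2 - meval x h\<bar> < e / 2"
      using h(2)[of x] x by (simp add: g_restrict)
    ultimately show "0 < meval x (p + h)"
      unfolding meval_add abs_less_iff by linarith
  next
    fix z assume z: "z \<in> B"
    have "g z \<le> meval z q - e"
    proof (rule g_le)
      fix x assume "x \<in> A"
      then show "- meval x p - M * d x z \<le> meval z q - e"
        using e(2)[of "(x, z)"] z by (simp add: s_def)
    qed
    moreover have "\<bar>g z + e / 2 - meval z h\<bar> < e / 2"
      using h(2)[of z] z by (simp add: g_restrict)
    ultimately show "0 < meval z (q - h)"
      unfolding meval_diff abs_less_iff by linarith
  qed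
qed

text \<open>
  Induction on the number of blocks. The last block meets the earlier ones only in variables \<open>J \<subseteq> I k\<close>; a
  separating polynomial in \<open>J\<close> is subtracted from the last summand and added to the \<open>k\<close>-th one, which
  introduces no new variables into either.
\<close>

theorem positive_decomposition:
  fixes P :: "nat \<Rightarrow> (nat \<Rightarrow> real) set"
  assumes "\<And>i. i \<in> {1..t} \<Longrightarrow> finite (I i)"
    and "\<And>i x y. i \<in> {1..t} \<Longrightarrow> x \<in> P i \<Longrightarrow> (\<And>j. j \<in> I i \<Longrightarrow> x j = y j) \<Longrightarrow> y \<in> P i"
    and "\<And>i. i \<in> {1..t} \<Longrightarrow> closed (P i)"
    and "\<And>i. i \<in> {1..t} \<Longrightarrow> \<exists>B. \<forall>x\<in>P i. \<forall>j\<in>I i. \<bar>x j\<bar> \<le> B"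
    and "\<And>i. i \<in> {1..t} - {1} \<Longrightarrow> \<exists>k\<in>{1..i - 1}. I i \<inter> (\<Union>j\<in>{1..i - 1}. I j) \<subseteq> I k"
    and "\<And>i. i \<in> {1..t} \<Longrightarrow> f i \<in> mpoly_ring (I i)"
    and "\<And>x. (\<And>i. i \<in> {1..t} \<Longrightarrow> x \<in> P i) \<Longrightarrow> 0 < meval x (\<Sum>i=1..t. f i)"
  shows "\<exists>g. (\<forall>i\<in>{1..t}. g i \<in> mpoly_ring (I i) \<and> (\<forall>x\<in>P i. 0 < meval x (g i))) \<and>
    (\<Sum>i=1..t. g i) = (\<Sum>i=1..t. f i)"
  using assms
proof (induction t arbitrary: f)
  case 0
  then show ?case by simp
next
  case (Suc t)
  show ?case
  proof (cases "t = 0")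
    case True
    then show ?thesis
      using Suc.prems(6,7) by (intro exI[of _ f]) auto
  next
    case False
    let ?V = "\<Union>i\<in>{1..t}. I i"
    let ?J = "I (Suc t) \<inter> ?V"
    obtain k where k: "k \<in> {1..t}" "?J \<subseteq> I k"
      using Suc.prems(5)[of "Suc t"] False by auto
    have in_t: "i \<in> {1..Suc t}" if "i \<in> {1..t}" for i
      using that by simp
    have last: "Suc t \<in> {1..Suc t}"
      by simp
    have local: "y \<in> P i" if "i \<in> {1..Suc t}" "x \<in> P i" "\<And>j. j \<in> I i \<Longrightarrow> x j = y j" for i x y
      using Suc.prems(2) that by blast
    obtain B where B: "\<And>i x j. i \<in> {1..Suc t} \<Longrightarrow> x \<in> P i \<Longrightarrow> j \<in> I i \<Longrightarrow> \<bar>x j\<bar> \<le> B i"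
      using bchoice[of "{1..Suc t}" "\<lambda>i B. \<forall>x\<in>P i. \<forall>j\<in>I i. \<bar>x j\<bar> \<le> B"] Suc.prems(4) by blast
    have compact_zero_ext: "compact ({x. \<forall>j. j \<notin> V \<longrightarrow> x j = 0} \<inter> (\<Inter>i\<in>S. P i))"
      if S: "S \<subseteq> {1..Suc t}" and V: "V = (\<Union>i\<in>S. I i)" for S V
    proof -
      let ?N = "\<Sum>i\<in>S. \<bar>B i\<bar>"
      have fin: "finite S"
        using S by (rule finite_subset) simp
      have "{x. \<forall>j. j \<notin> V \<longrightarrow> x j = 0} \<inter> (\<Inter>i\<in>S. P i) = coord_box V ?N \<inter> (\<Inter>i\<in>S. P i)"
      proof -
        have "\<bar>x j\<bar> \<le> ?N" if xj: "x \<in> (\<Inter>i\<in>S. P i)" "j \<in> V" for x j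
        proof -
          obtain i where i: "i \<in> S" "j \<in> I i"
            using xj(2) V by blast
          have "\<bar>x j\<bar> \<le> B i"
            using B i xj(1) S by blast
          also have "B i \<le> \<bar>B i\<bar>"
            by simp
          also have "\<bar>B i\<bar> \<le> ?N"
            using fin i by (intro member_le_sum) auto
          finally show ?thesis .
        qed
        then show ?thesis
          by (auto simp: coord_box_def)
      qed
      moreover have "closed (\<Inter>i\<in>S. P i)"
        using Suc.prems(3) S by (intro closed_INT) blast
      ultimately show ?thesis
        using compact_Int_closed[OF compact_coord_box] by metis
    qed
    define A1 where "A1 = {x. \<forall>j. j \<notin> ?V \<longrightarrow> x j = 0} \<inter> (\<Inter>i\<in>{1..t}. P i)"
    define A2 where "A2 = {x. \<forall>j. j \<notin> I (Suc t) \<longrightarrow> x j = 0} \<inter> (\<Inter>i\<in>{Suc t}. P i)"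
    let ?p = "\<Sum>i=1..t. f i"
    have A1: "compact A1"
      unfolding A1_def by (rule compact_zero_ext) auto
    have A2: "compact A2"
      unfolding A2_def by (rule compact_zero_ext) auto
    have J: "finite ?J"
      using Suc.prems(1)[OF last] by simp
    have p: "?p \<in> mpoly_ring ?V"
      using Suc.prems(6) mpoly_ring_mono[of "I _" ?V] by (intro mpoly_ring_sum) force
    have glue: "0 < meval x ?p + meval z (f (Suc t))"
      if x: "x \<in> A1" and z: "z \<in> A2" and xz: "\<And>j. j \<in> ?J \<Longrightarrow> x j = z j" for x z
    proof -
      define y where "y j = (if j \<in> ?V then x j else z j)" for j
      have yz: "y j = z j" if "j \<in> I (Suc t)" for j
        using xz that by (auto simp: y_def)
      have "y \<in> P i" if i: "i \<in> {1..Suc t}" for i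
      proof (cases "i = Suc t")
        case True
        then show ?thesis
          using z local[OF last, of z y] yz by (simp add: A2_def)
      next
        case False
        then have "i \<in> {1..t}"
          using i by simp
        then show ?thesis
          using x by (intro local[OF i, of x y]) (auto simp: A1_def y_def)
      qed
      then have "0 < meval y (\<Sum>i=1..Suc t. f i)"
        by (rule Suc.prems(7))
      moreover have "meval y ?p = meval x ?p"
        by (rule meval_cong[OF p]) (simp add: y_def)
      moreover have "meval y (f (Suc t)) = meval z (f (Suc t))"
        by (rule meval_cong[OF Suc.prems(6)[OF last]]) (rule yz)
      ultimately show ?thesis
        by simp
    qed
    obtain h where h: "h \<in> mpoly_ring ?J"
      "\<And>x. x \<in> A1 \<Longrightarrow> 0 < meval x (?p + h)" "\<And>z. z \<in> A2 \<Longrightarrow> 0 < meval z (f (Suc t) - h)"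
      using separating_polynomial[OF A1 A2 J glue] by blast
    define f' where "f' = f(k := f k + h)"
    have f'_sum: "(\<Sum>i=1..t. f' i) = ?p + h"
    proof -
      have "f' i = f i + (if i = k then h else 0)" for i
        by (simp add: f'_def)
      then show ?thesis
        using k(1) by (simp add: sum.distrib)
    qed
    have "\<exists>g. (\<forall>i\<in>{1..t}. g i \<in> mpoly_ring (I i) \<and> (\<forall>x\<in>P i. 0 < meval x (g i))) \<and>
      (\<Sum>i=1..t. g i) = (\<Sum>i=1..t. f' i)"
    proof (rule Suc.IH)
      show "\<exists>k\<in>{1..i - 1}. I i \<inter> (\<Union>j\<in>{1..i - 1}. I j) \<subseteq> I k" if "i \<in> {1..t} - {1}" for i
        using Suc.prems(5)[of i] that by simp
      show "f' i \<in> mpoly_ring (I i)" if "i \<in> {1..t}" for i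
        using Suc.prems(6)[OF in_t[OF that]] h(1) mpoly_ring_mono[OF k(2)]
        by (auto simp: f'_def intro: mpoly_ring_add)
      show "0 < meval x (\<Sum>i=1..t. f' i)" if x: "\<And>i. i \<in> {1..t} \<Longrightarrow> x \<in> P i" for x
      proof -
        have "restrict0 ?V x \<in> P i" if "i \<in> {1..t}" for i
          using that by (intro local[OF in_t x]) (auto simp: restrict0_def)
        then have "restrict0 ?V x \<in> A1"
          by (auto simp: A1_def restrict0_def)
        then have "0 < meval (restrict0 ?V x) (?p + h)"
          by (rule h(2))
        moreover have "?p + h \<in> mpoly_ring ?V"
          using p h(1) mpoly_ring_mono[of ?J ?V] by (intro mpoly_ring_add) auto
        ultimately show ?thesis
          by (simp only: f'_sum meval_restrict0)
      qed
      show "y \<in> P i" if "i \<in> {1..t}" "x \<in> P i" "\<And>j. j \<in> I i \<Longrightarrow> x j = y j" for i x y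
        using local[OF in_t] that by blast
    qed (use Suc.prems(1,3,4) in_t in blast)+
    then obtain g where g: "\<And>i. i \<in> {1..t} \<Longrightarrow> g i \<in> mpoly_ring (I i) \<and> (\<forall>x\<in>P i. 0 < meval x (g i))"
      "(\<Sum>i=1..t. g i) = ?p + h"
      unfolding f'_sum by blast
    define g' where "g' = g(Suc t := f (Suc t) - h)"
    have h_last: "h \<in> mpoly_ring (I (Suc t))"
      using h(1) mpoly_ring_mono[of ?J "I (Suc t)"] by auto
    have "g' i \<in> mpoly_ring (I i) \<and> (\<forall>x\<in>P i. 0 < meval x (g' i))" if i: "i \<in> {1..Suc t}" for i
    proof (cases "i = Suc t")
      case True
      have ring: "f (Suc t) - h \<in> mpoly_ring (I (Suc t))"
        using Suc.prems(6)[OF last] h_last by (rule mpoly_ring_diff)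
      have "0 < meval x (f (Suc t) - h)" if "x \<in> P (Suc t)" for x
      proof -
        have "restrict0 (I (Suc t)) x \<in> P (Suc t)"
          using that by (intro local[OF last that]) (simp add: restrict0_def)
        then have "restrict0 (I (Suc t)) x \<in> A2"
          by (simp add: A2_def restrict0_def)
        from h(3)[OF this] show ?thesis
          by (simp only: meval_restrict0[OF ring])
      qed
      then show ?thesis
        using True ring by (simp add: g'_def)
    next
      case False
      then show ?thesis
        using g(1)[of i] i by (simp add: g'_def)
    qed
    moreover have "(\<Sum>i=1..Suc t. g' i) = (\<Sum>i=1..Suc t. f i)"
      using g(2) by (simp add: g'_def)
    ultimately show ?thesis
      by blast
  qed
qed

section \<open>Block-diagonal matrices\<close>

lemma psd_four_block_diag:
  assumes A: "A \<in> carrier_mat n n" and B: "B \<in> carrier_mat m m"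
  shows "psd (four_block_mat A (0\<^sub>m n m) (0\<^sub>m m n) B) \<longleftrightarrow> psd A \<and> psd B" (is "psd ?M \<longleftrightarrow> _")
proof -
  have M: "?M \<in> carrier_mat (n + m) (n + m)"
    using A B by simp
  have sym: "sym_mat ?M \<longleftrightarrow> sym_mat A \<and> sym_mat B"
  proof -
    have "sym_mat ?M \<Longrightarrow> sym_mat A"
      unfolding sym_mat_iff[OF M] sym_mat_iff[OF A]
    proof (intro allI impI)
      fix i j assume *: "\<forall>i<n + m. \<forall>j<n + m. ?M $$ (i, j) = ?M $$ (j, i)" and ij: "i < n" "j < n"
      then show "A $$ (i, j) = A $$ (j, i)"
        using *[rule_format, of i j] A B by simp
    qed
    moreover have "sym_mat ?M \<Longrightarrow> sym_mat B"
      unfolding sym_mat_iff[OF M] sym_mat_iff[OF B]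
    proof (intro allI impI)
      fix i j assume *: "\<forall>i<n + m. \<forall>j<n + m. ?M $$ (i, j) = ?M $$ (j, i)" and ij: "i < m" "j < m"
      then show "B $$ (i, j) = B $$ (j, i)"
        using *[rule_format, of "n + i" "n + j"] A B by simp
    qed
    moreover have "sym_mat A \<Longrightarrow> sym_mat B \<Longrightarrow> sym_mat ?M"
      unfolding sym_mat_def using transpose_four_block_mat[OF A _ _ B, of "0\<^sub>m n m" "0\<^sub>m m n"] by simp
    ultimately show ?thesis
      by blast
  qed
  have form: "(a @\<^sub>v b) \<bullet> (?M *\<^sub>v (a @\<^sub>v b)) = a \<bullet> (A *\<^sub>v a) + b \<bullet> (B *\<^sub>v b)"
    if a: "a \<in> carrier_vec n" and b: "b \<in> carrier_vec m" for a b
  proof -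
    have "0\<^sub>m n m *\<^sub>v b = 0\<^sub>v n" "0\<^sub>m m n *\<^sub>v a = 0\<^sub>v m"
      using a b by (auto simp: scalar_prod_def)
    then have "?M *\<^sub>v (a @\<^sub>v b) = (A *\<^sub>v a) @\<^sub>v (B *\<^sub>v b)"
      using four_block_mat_mult_vec[OF A _ _ B a b, of "0\<^sub>m n m" "0\<^sub>m m n"] a b A B by simp
    then show ?thesis
      using a b A B by (simp add: scalar_prod_append[of _ n _ m])
  qed
  show ?thesis
  proof
    assume psd: "psd ?M"
    have "0 \<le> a \<bullet> (A *\<^sub>v a)" if a: "a \<in> carrier_vec n" for a
    proof -
      have "0 \<le> (a @\<^sub>v 0\<^sub>v m) \<bullet> (?M *\<^sub>v (a @\<^sub>v 0\<^sub>v m))"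
        using psd a M by (auto simp: psd_def)
      then show ?thesis
        using form[OF a, of "0\<^sub>v m"] B by simp
    qed
    moreover have "0 \<le> b \<bullet> (B *\<^sub>v b)" if b: "b \<in> carrier_vec m" for b
    proof -
      have "0 \<le> (0\<^sub>v n @\<^sub>v b) \<bullet> (?M *\<^sub>v (0\<^sub>v n @\<^sub>v b))"
        using psd b M by (auto simp: psd_def)
      then show ?thesis
        using form[OF _ b, of "0\<^sub>v n"] A by simp
    qed
    ultimately show "psd A \<and> psd B"
      using psd sym A B by (auto simp: psd_def)
  next
    assume psd: "psd A \<and> psd B"
    have "0 \<le> v \<bullet> (?M *\<^sub>v v)" if v: "v \<in> carrier_vec (n + m)" for v
    proof -
      have "v = vec_first v n @\<^sub>v vec_last v m"
        using v by simp
      then have "v \<bullet> (?M *\<^sub>v v) = vec_first v n \<bullet> (A *\<^sub>v vec_first v n) + vec_last v m \<bullet> (B *\<^sub>v vec_last v m)"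
        using form[of "vec_first v n" "vec_last v m"] by simp
      then show ?thesis
        using psd A B by (simp add: psd_def)
    qed
    then show "psd ?M"
      using psd sym M by (auto simp: psd_def)
  qed
qed

lemma diag_block_mat_pair:
  "A \<in> carrier_mat n n \<Longrightarrow> B \<in> carrier_mat m m \<Longrightarrow>
    diag_block_mat [A, B] = four_block_mat A (0\<^sub>m n m) (0\<^sub>m m n) B"
  unfolding diag_block_mat.simps(2)[of A "[B]"] Let_def diag_block_mat_singleton by simp

lemma psd_square: "psd A \<Longrightarrow> dim_col A = dim_row A"
  by (metis index_transpose_mat(2) psd_def sym_mat_def)

lemma psd_diag_block_mat:
  "(\<And>A. A \<in> set As \<Longrightarrow> psd A) \<Longrightarrow> psd (diag_block_mat As)"
proof (induction As)
  case Nil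
  then show ?case
    by (auto simp: psd_iff_sum[of _ 0] sym_mat_def)
next
  case (Cons A As)
  let ?D = "diag_block_mat As"
  have A: "psd A" and D: "psd ?D"
    using Cons by auto
  then have "A \<in> carrier_mat (dim_row A) (dim_row A)" "?D \<in> carrier_mat (dim_row ?D) (dim_row ?D)"
    by (auto simp: psd_square)
  from psd_four_block_diag[OF this] show ?case
    using A D by (simp add: Let_def psd_square)
qed

lemma eval_mat_diag_block_mat: "eval_mat x (diag_block_mat As) = diag_block_mat (map (eval_mat x) As)"
proof (induction As)
  case Nil
  then show ?case
    by (auto simp: eval_mat_def)
next
  case (Cons A As)
  have dims: "dim_row (diag_block_mat (map (eval_mat x) As)) = dim_row (diag_block_mat As)"
    "dim_col (diag_block_mat (map (eval_mat x) As)) = dim_col (diag_block_mat As)"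
    unfolding Cons[symmetric] by (simp_all add: eval_mat_def)
  show ?case
    by (rule eq_matI) (auto simp: Let_def dims eval_mat_def Cons[symmetric, unfolded eval_mat_def])
qed

lemma elements_mat_block:
  "A \<in> set As \<Longrightarrow> elements_mat A \<subseteq> elements_mat (diag_block_mat As)"
proof (induction As)
  case (Cons B Bs)
  let ?D = "diag_block_mat Bs"
  let ?M = "diag_block_mat (B # Bs)"
  have M: "?M \<in> carrier_mat (dim_row B + dim_row ?D) (dim_col B + dim_col ?D)"
    by (simp add: Let_def)
  have "elements_mat B \<subseteq> elements_mat ?M"
  proof
    fix p assume "p \<in> elements_mat B"
    then obtain i j where "i < dim_row B" "j < dim_col B" "p = B $$ (i, j)"
      by (auto simp: elements_mat_def)
    then show "p \<in> elements_mat ?M"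
      by (intro elements_matI[OF M, of i j]) (auto simp: Let_def)
  qed
  moreover have "elements_mat ?D \<subseteq> elements_mat ?M"
  proof
    fix p assume "p \<in> elements_mat ?D"
    then obtain i j where "i < dim_row ?D" "j < dim_col ?D" "p = ?D $$ (i, j)"
      by (auto simp: elements_mat_def)
    then show "p \<in> elements_mat ?M"
      by (intro elements_matI[OF M, of "dim_row B + i" "dim_col B + j"]) (auto simp: Let_def)
  qed
  moreover have "A = B \<or> elements_mat A \<subseteq> elements_mat ?D"
    using Cons.IH Cons.prems by auto
  ultimately show ?case
    by (meson order_trans)
qed simp

text \<open>
  The matrix \<open>diag(A, 1 - A)\<close> has trace \<open>m\<close>, and is positive semidefinite only where \<open>A\<close> is.
\<close>

lemma nonlinear_block:
  assumes A: "A \<in> carrier_mat m m" "sym_mat A" "elements_mat A \<subseteq> mpoly_ring I" and I: "finite I"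
    and U_def: "U = diag_block_mat [A, 1\<^sub>m m - A]"
    and gen: "mpoly_ring I \<subseteq> {a - b | a b. a \<in> kron_cone U \<and> b \<in> kron_cone U}"
    and f: "f \<in> mpoly_ring I" and pos: "\<And>x. psd (eval_mat x A) \<Longrightarrow> 0 < meval x f"
  shows "f \<in> kron_cone U"
proof -
  have A': "1\<^sub>m m - A \<in> carrier_mat m m"
    using A(1) by (rule minus_carrier_mat)
  have U4: "U = four_block_mat A (0\<^sub>m m m) (0\<^sub>m m m) (1\<^sub>m m - A)"
    unfolding U_def using A(1) A' by (rule diag_block_mat_pair)
  have U: "U \<in> carrier_mat (m + m) (m + m)"
    using A(1) A' by (simp add: U4)
  have sym': "sym_mat (1\<^sub>m m - A)"
    using A(2) unfolding sym_mat_iff[OF A'] sym_mat_iff[OF A(1)] using A(1) by auto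
  have sym: "sym_mat U"
    unfolding U4 sym_mat_def using A A' sym' transpose_four_block_mat[OF A(1) _ _ A', of "0\<^sub>m m m" "0\<^sub>m m m"]
    by (simp add: sym_mat_def)
  have "elements_mat (1\<^sub>m m - A) \<subseteq> mpoly_ring I"
  proof
    fix p assume "p \<in> elements_mat (1\<^sub>m m - A)"
    then obtain i j where ij: "i < m" "j < m" "p = (1\<^sub>m m - A) $$ (i, j)"
      using elements_matD carrier_matD[OF A'] by metis
    then have "A $$ (i, j) \<in> mpoly_ring I"
      using A by auto
    then show "p \<in> mpoly_ring I"
      using ij A(1) by (auto intro: mpoly_ring_diff mpoly_ring_uminus)
  qed
  then have entries: "elements_mat U \<subseteq> mpoly_ring I"
    using elements_diag_block_mat[of "[A, 1\<^sub>m m - A]"] A(3) by (auto simp: U_def simp del: diag_block_mat.simps)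
  have trace: "(\<Sum>i<m + m. U $$ (i, i)) = mconst (real m)"
  proof -
    have "(\<Sum>i<m + k. U $$ (i, i)) = (\<Sum>i<m. U $$ (i, i)) + (\<Sum>i<k. U $$ (m + i, m + i))" for k
      by (induction k) (simp_all add: add_ac)
    then have "(\<Sum>i<m + m. U $$ (i, i)) = (\<Sum>i<m. U $$ (i, i)) + (\<Sum>i<m. U $$ (m + i, m + i))" .
    also have "\<dots> = (\<Sum>i<m. A $$ (i, i)) + (\<Sum>i<m. 1 - A $$ (i, i))"
      unfolding U4 using A(1) by (intro arg_cong2[of _ _ _ _ "(+)"] sum.cong) auto
    also have "\<dots> = mconst (real m)"
      by (simp add: mconst_of_nat flip: sum.distrib)
    finally show ?thesis .
  qed
  have bounded: "mpoly_ring I \<subseteq> poly_semiring.bounded_elems (multipliers I U)"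
    by (rule bounded_of_constant_trace[OF U sym entries trace gen])
  show ?thesis
  proof (rule kron_cone_positivstellensatz[OF U sym entries I _ f])
    show "mvar j \<in> poly_semiring.bounded_elems (multipliers I U)" if "j \<in> I" for j
      using bounded that by auto
    fix x assume "psd (eval_mat x U)"
    also have "eval_mat x U = diag_block_mat [eval_mat x A, eval_mat x (1\<^sub>m m - A)]"
      by (simp only: U_def eval_mat_diag_block_mat list.map)
    also have "\<dots> = four_block_mat (eval_mat x A) (0\<^sub>m m m) (0\<^sub>m m m) (eval_mat x (1\<^sub>m m - A))"
      using A(1) by (intro diag_block_mat_pair) (auto simp: eval_mat_def)
    finally have "psd (eval_mat x A)"
      using psd_four_block_diag[of "eval_mat x A" m "eval_mat x (1\<^sub>m m - A)" m] A(1) A' by (simp add: eval_mat_def)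
    then show "0 < meval x f"
      by (rule pos)
  qed
qed

lemma linear_block:
  assumes A: "A \<in> carrier_mat m m" "sym_mat A" "elements_mat A \<subseteq> mpoly_ring I" "linear_mat A"
    and I: "finite I" "0 \<notin> I"
    and ne: "psd (eval_mat x0 A)"
    and bdd: "\<And>x j. psd (eval_mat x A) \<Longrightarrow> j \<in> I \<Longrightarrow> \<bar>x j\<bar> \<le> B"
    and f: "f \<in> mpoly_ring I" and pos: "\<And>x. psd (eval_mat x A) \<Longrightarrow> 0 < meval x f"
  shows "f \<in> kron_cone A"
proof (rule kron_cone_positivstellensatz[OF A(1-3) I(1) _ f pos])
  fix j assume j: "j \<in> I"
  show "mvar j \<in> poly_semiring.bounded_elems (multipliers I A)"
  proof (rule bounded_of_compact_spectrahedron[OF A(1-3) _ I ne _ j])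
    show "total_degree p \<le> 1" if "p \<in> elements_mat A" for p
      using A(4) that by (simp add: linear_mat_def)
    show "\<bar>x k\<bar> \<le> B" if "psd (eval_mat x A)" "k \<in> I" for x k
      using bdd that .
  qed
qed

section \<open>Sparse certificates\<close>

lemma eval_mat_cong:
  assumes "elements_mat A \<subseteq> mpoly_ring I" "\<And>j. j \<in> I \<Longrightarrow> x j = y j"
  shows "eval_mat x A = eval_mat y A"
  unfolding eval_mat_def
proof (rule eq_matI)
  fix i j assume "i < dim_row (map_mat (meval y) A)" "j < dim_col (map_mat (meval y) A)"
  then have ij: "i < dim_row A" "j < dim_col A"
    by simp_all
  then have "A $$ (i, j) \<in> elements_mat A"
    by (intro elements_matI[of A "dim_row A" "dim_col A" i j]) auto
  then have "meval x (A $$ (i, j)) = meval y (A $$ (i, j))"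
    using assms by (intro meval_cong[of _ I]) auto
  then show "map_mat (meval x) A $$ (i, j) = map_mat (meval y) A $$ (i, j)"
    using ij by simp
qed simp_all

lemma restrict_mem_psd_set:
  assumes "elements_mat A \<subseteq> mpoly_ring I"
  shows "restrict x I \<in> psd_set I A \<longleftrightarrow> psd (eval_mat x A)"
proof -
  have "eval_mat (restrict x I) A = eval_mat x A"
    using assms by (rule eval_mat_cong) simp
  then show ?thesis
    by (simp add: psd_set_def)
qed

text \<open>
  Projections of a compact set to coordinates are bounded, and \<open>A(x)\<close> depends on the coordinates in \<open>I\<close> only.
  From here on, points are total functions.
\<close>

lemma psd_set_bounded:
  assumes I: "finite I" and A: "elements_mat A \<subseteq> mpoly_ring I"
    and compact: "compactin (real_space I) (psd_set I A)"
  shows "\<exists>B. \<forall>x. psd (eval_mat x A) \<longrightarrow> (\<forall>j\<in>I. \<bar>x j\<bar> \<le> B)"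
proof -
  have "\<exists>b. \<forall>x\<in>psd_set I A. \<bar>x j\<bar> \<le> b" if j: "j \<in> I" for j
  proof -
    have "compactin euclideanreal ((\<lambda>x. x j) ` psd_set I A)"
      using compact continuous_map_product_projection[OF j] by (rule image_compactin)
    then have "bounded ((\<lambda>x. x j) ` psd_set I A)"
      by (simp add: compact_imp_bounded)
    then show ?thesis
      by (auto simp: bounded_iff)
  qed
  then obtain b where b: "\<And>j x. j \<in> I \<Longrightarrow> x \<in> psd_set I A \<Longrightarrow> \<bar>x j\<bar> \<le> b j"
    using bchoice[of I "\<lambda>j b. \<forall>x\<in>psd_set I A. \<bar>x j\<bar> \<le> b"] by blast
  have "\<bar>x j\<bar> \<le> (\<Sum>j\<in>I. \<bar>b j\<bar>)" if x: "psd (eval_mat x A)" and j: "j \<in> I" for x j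
  proof -
    have "\<bar>x j\<bar> \<le> b j"
      using b[OF j, of "restrict x I"] x j by (simp add: restrict_mem_psd_set[OF A])
    also have "\<dots> \<le> \<bar>b j\<bar>"
      by simp
    also have "\<dots> \<le> (\<Sum>j\<in>I. \<bar>b j\<bar>)"
      using I j by (intro member_le_sum) auto
    finally show ?thesis .
  qed
  then show ?thesis
    by blast
qed

lemma closed_psd_eval:
  assumes "A \<in> carrier_mat d d" "sym_mat A"
  shows "closed {x. psd (eval_mat x A)}"
  unfolding psd_eval_iff[OF assms]
  by (intro closed_Collect_all closed_Collect_le continuous_on_const continuous_meval)

theorem theorem3p23:
  fixes n t :: nat
    and q :: "nat \<Rightarrow> nat"
    and G :: "mpoly mat"
    and Gs :: "nat \<Rightarrow> mpoly mat"
    and I :: "nat \<Rightarrow> nat set"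
    and f :: mpoly
    and fs :: "nat \<Rightarrow> mpoly"
  assumes blocks: "\<And>i. i \<in> {1..t} \<Longrightarrow> Gs i \<in> carrier_mat (q i) (q i) \<and> sym_mat (Gs i)"
    and G: "G = diag_block_mat (map Gs [1..<Suc t])"
    and cover: "{1..n} = (\<Union>i\<in>{1..t}. I i)"
    and entries: "\<And>i. i \<in> {1..t} \<Longrightarrow> elements_mat (Gs i) \<subseteq> mpoly_ring (I i)"
    and running_intersection:
      "\<And>i. i \<in> {1..t} - {1} \<Longrightarrow> \<exists>k\<in>{1..i - 1}. I i \<inter> (\<Union>j\<in>{1..i - 1}. I j) \<subseteq> I k"
    and linear_case: "\<And>i. linear_mat G \<Longrightarrow> i \<in> {1..t} \<Longrightarrow>
      compactin (real_space (I i)) (psd_set (I i) (Gs i)) \<and>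
      (real_space (I i)) interior_of (psd_set (I i) (Gs i)) \<noteq> {}"
    and nonlinear_case: "\<And>i. \<not> linear_mat G \<Longrightarrow> i \<in> {1..t} \<Longrightarrow>
      compactin (real_space (I i)) (psd_set (I i) (Gs i)) \<and>
      (\<forall>x\<in>psd_set (I i) (Gs i). psd (1\<^sub>m (q i) - eval_mat x (Gs i))) \<and>
      mpoly_ring (I i) = {a - b | a b. a \<in> H_cone G (Gs i) \<and> b \<in> H_cone G (Gs i)}"
    and f_decomp: "f = (\<Sum>i=1..t. fs i)"
    and fs: "\<And>i. i \<in> {1..t} \<Longrightarrow> fs i \<in> mpoly_ring (I i)"
    and pos: "\<And>x. x \<in> psd_set {1..n} G \<Longrightarrow> 0 < meval x f"
  shows "f \<in> {\<Sum>i=1..t. h i | h. \<forall>i\<in>{1..t}. h i \<in> H_cone G (Gs i)}"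
proof -
  define P where "P i = {x. psd (eval_mat x (Gs i))}" for i
  have sub: "I i \<subseteq> {1..n}" if "i \<in> {1..t}" for i
    using cover that by blast
  have fin: "finite (I i)" if "i \<in> {1..t}" for i
    using sub[OF that] by (rule finite_subset) simp
  have compact: "compactin (real_space (I i)) (psd_set (I i) (Gs i))" if "i \<in> {1..t}" for i
    using linear_case nonlinear_case that by blast
  have bounded: "\<exists>B. \<forall>x. psd (eval_mat x (Gs i)) \<longrightarrow> (\<forall>j\<in>I i. \<bar>x j\<bar> \<le> B)" if "i \<in> {1..t}" for i
    using that by (intro psd_set_bounded fin entries compact)
  have local: "psd (eval_mat y (Gs i))"
    if i: "i \<in> {1..t}" and "psd (eval_mat x (Gs i))" "\<And>j. j \<in> I i \<Longrightarrow> x j = y j" for i x y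
    using eval_mat_cong[OF entries[OF i], of x y] that by simp
  have pos': "0 < meval x (\<Sum>i=1..t. fs i)" if x: "\<And>i. i \<in> {1..t} \<Longrightarrow> x \<in> P i" for x
  proof -
    let ?x = "restrict x {1..n}"
    have "psd (eval_mat ?x (Gs i))" if i: "i \<in> {1..t}" for i
    proof (rule local[OF i])
      show "psd (eval_mat x (Gs i))"
        using x[OF i] by (simp add: P_def)
      show "x j = ?x j" if "j \<in> I i" for j
        using sub[OF i] that by auto
    qed
    then have "psd (eval_mat ?x G)"
      unfolding G eval_mat_diag_block_mat by (intro psd_diag_block_mat) auto
    then have "?x \<in> psd_set {1..n} G"
      by (simp add: psd_set_def)
    then have "0 < meval ?x f"
      by (rule pos)
    moreover have "f \<in> mpoly_ring {1..n}"
      unfolding f_decomp using fs mpoly_ring_mono[OF sub] by (intro mpoly_ring_sum) blast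
    then have "meval ?x f = meval x f"
      by (rule meval_cong) simp
    ultimately show ?thesis
      by (simp only: f_decomp)
  qed
  have "\<exists>g. (\<forall>i\<in>{1..t}. g i \<in> mpoly_ring (I i) \<and> (\<forall>x\<in>P i. 0 < meval x (g i))) \<and>
    (\<Sum>i=1..t. g i) = (\<Sum>i=1..t. fs i)"
  proof (rule positive_decomposition[OF fin _ _ _ running_intersection fs pos'])
    show "y \<in> P i" if "i \<in> {1..t}" "x \<in> P i" "\<And>j. j \<in> I i \<Longrightarrow> x j = y j" for i x y
      using local that by (simp add: P_def)
    show "closed (P i)" if "i \<in> {1..t}" for i
      unfolding P_def using blocks[OF that] by (intro closed_psd_eval[of _ "q i"]) auto
    show "\<exists>B. \<forall>x\<in>P i. \<forall>j\<in>I i. \<bar>x j\<bar> \<le> B" if "i \<in> {1..t}" for i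
      using bounded[OF that] by (simp add: P_def)
  qed
  then obtain g where g: "\<And>i. i \<in> {1..t} \<Longrightarrow> g i \<in> mpoly_ring (I i)"
      "\<And>i x. i \<in> {1..t} \<Longrightarrow> psd (eval_mat x (Gs i)) \<Longrightarrow> 0 < meval x (g i)"
      "(\<Sum>i=1..t. g i) = f"
    unfolding f_decomp P_def by blast
  have "g i \<in> H_cone G (Gs i)" if i: "i \<in> {1..t}" for i
  proof (cases "linear_mat G")
    case True
    have "Gs i \<in> set (map Gs [1..<Suc t])"
      using i by (auto simp del: upt_Suc)
    then have "elements_mat (Gs i) \<subseteq> elements_mat G"
      unfolding G by (rule elements_mat_block)
    then have lin: "linear_mat (Gs i)"
      using True by (auto simp: linear_mat_def)
    obtain x0 where "x0 \<in> psd_set (I i) (Gs i)"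
      using linear_case[OF True i] interior_of_subset[of "real_space (I i)" "psd_set (I i) (Gs i)"] by auto
    then have x0: "psd (eval_mat x0 (Gs i))"
      by (simp add: psd_set_def)
    obtain B where B: "\<And>x j. psd (eval_mat x (Gs i)) \<Longrightarrow> j \<in> I i \<Longrightarrow> \<bar>x j\<bar> \<le> B"
      using bounded[OF i] by blast
    have "0 \<notin> I i"
      using sub[OF i] by auto
    then have "g i \<in> kron_cone (Gs i)"
      using blocks[OF i] entries[OF i] lin fin[OF i] x0 B g(1,2)[OF i]
      by (intro linear_block[of "Gs i" "q i" "I i" x0 B "g i"]) auto
    then show ?thesis
      using True by (simp add: H_cone_def)
  next
    case False
    have "dim_row (Gs i) = q i"
      using blocks[OF i] by auto
    then have H: "H_cone G (Gs i) = kron_cone (diag_block_mat [Gs i, 1\<^sub>m (q i) - Gs i])"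
      using False by (simp add: H_cone_def del: diag_block_mat.simps)
    have "mpoly_ring (I i) \<subseteq> {a - b | a b. a \<in> H_cone G (Gs i) \<and> b \<in> H_cone G (Gs i)}"
      using nonlinear_case[OF False i] by blast
    then show ?thesis
      unfolding H using blocks[OF i] entries[OF i] fin[OF i] g(1,2)[OF i]
      by (intro nonlinear_block[of "Gs i" "q i" "I i" _ "g i"]) auto
  qed
  then show ?thesis
    using g(3) by blast
qed

end
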